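(* The following two Lax representations (pairs of edge based matrices $L,M$ on $\mathbb{Z}^2$ satisfying $M_1L=L_2M$) are gauge equivalent: (a) the Lax representation for discrete constant mean curvature and constant positive Gaussian curvature nets, $$L=\begin{pmatrix}a&\lambda b+\frac1{\lambda b}\\-\frac{\bar b}\lambda-\frac\lambda{\bar b}&\bar a\end{pmatrix},\qquad M=\begin{pmatrix}d&\lambda e+\frac1{\lambda e}\\-\frac{\bar e}\lambda-\frac\lambda{\bar e}&\bar d\end{pmatrix},\qquad\lambda=e^{\mathrm{i}t},$$ with complex functions $a,b$ on the edges of the first lattice direction and $d,e$ on the edges of the second lattice direction ($b,e\neq0$); (b) the Lax representation on the diagonal net $D=\{(i,j,i,j)\}\cong\mathbb{Z}^2$ of a $C^+$ lattice, $$L=(\lambda+\tfrac1\lambda p^3_1)(\lambda+\tfrac1\lambda p^1),\qquad M=(\lambda+\tfrac1\lambda p^4_2)(\lambda+\tfrac1\lambda p^2),\qquad \lambda=e^{\mathrm{i}t},$$ where $p^i=\begin{pmatrix}0&d^i\\-(\alpha^i)^2/d^i&0\end{pmatrix}$ is the map of the $C^+$ lattice with edges $d^i$ and labelling $\alpha$.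
   Context: Gauge equivalence. For a pair $L$ (on edges of the first direction of $\mathbb{Z}^2$), $M$ (on edges of the second direction) depending on a spectral parameter $\lambda$, subscripts denote shifts in the lattice directions of $\mathbb{Z}^2$; $M_1L=L_2M$ is the compatibility condition of the frame equations $\Phi_1=L\Phi$, $\Phi_2=M\Phi$. A gauge is a transformation $\Phi\mapsto G\Phi$ with a vertex based invertible matrix $G$ not depending on $\lambda$, so $L\mapsto G_1LG^{-1}$, $M\mapsto G_2MG^{-1}$. Two Lax representations are gauge equivalent if every solution pair of either one can be transformed into a solution pair of the other by a gauge, together with a reparametrization of the spectral parameter (such as $\lambda^2\to\lambda$) and multiplication of the matrices by nonzero scalars that do not affect the compatibility condition. $C^+$ lattice. For maps on $\mathbb{Z}^4$ write $f_i=f(x+e_i)$, $f_{ij}=f(x+e_i+e_j)$, and for edge based maps $p^i=p^i(x)$ (value on $(x,x+e_i)$), $p^i_j=p^i(x+e_j)$. A cross-ratio system is a map $f:\mathbb{Z}^4\to\mathbb{C}$, with the four points of each quad pairwise distinct, together with an edge labelling $\alpha$ with values in $\mathbb{C}\setminus\{0\}$, $\alpha^i_j=\alpha^i$ for $i\neq j$, such that with $d^i=f_i-f$ one has $\frac{d^id^i_j}{d^jd^j_i}=\frac{(\alpha^i)^2}{(\alpha^j)^2}$ for $i\neq j$. Its map $s:\mathbb{Z}^4\to\mathbb{C}$ is defined by $s(\mathbf{0})=1$, $d^i=\alpha^is_is$. It is a $C^+$ lattice if for every $x\in D$: $s_1(x)\bar s_3(x)=1$, $s_2(x)\bar s_4(x)=1$,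 $\alpha^1(x)\bar\alpha^3(x)=-1$, $\alpha^2(x)\bar\alpha^4(x)=-1$. Nondegeneracy (pairwise distinct points on quads) is a standing assumption, so only solutions of (a) corresponding to nondegenerate lattices are considered. *)

theory Defs
  imports "HOL-Analysis.Analysis"
begin

section \<open>Lax representations on \<open>\<int>\<^sup>2\<close> and gauge equivalence\<close>

text \<open>
  \<open>L i j z\<close> is the matrix on the edge from \<open>(i, j)\<close> to \<open>(i + 1, j)\<close> and \<open>M i j z\<close> the matrix on
  the edge from \<open>(i, j)\<close> to \<open>(i, j + 1)\<close>, for the spectral parameter \<open>z\<close>. As \<open>z = exp (\<i> t)\<close>,
  only the values on the unit circle matter for compatibility and gauge equivalence.
\<close>

type_synonym lax = "int \<Rightarrow> int \<Rightarrow> complex \<Rightarrow> complex^2^2"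

definition mat2 :: "complex \<Rightarrow> complex \<Rightarrow> complex \<Rightarrow> complex \<Rightarrow> complex^2^2" where
  "mat2 x y u v = vector [vector [x, y], vector [u, v]]"

definition compatible :: "lax \<Rightarrow> lax \<Rightarrow> bool" where
  "compatible L M \<longleftrightarrow>
     (\<forall>i j z. cmod z = 1 \<longrightarrow> M (i + 1) j z ** L i j z = L i (j + 1) z ** M i j z)"

definition reparametrization :: "(complex \<Rightarrow> complex) \<Rightarrow> bool" where
  "reparametrization \<rho> \<longleftrightarrow> continuous_on (sphere 0 1) \<rho> \<and> \<rho> ` sphere 0 1 = sphere 0 1"

text \<open>
  The condition on the scalars \<open>c\<close>, \<open>c'\<close> says that the factors on both sides of
  \<open>M\<^sub>1 L = L\<^sub>2 M\<close> agree.
\<close>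

definition gauge_related ::
    "(complex \<Rightarrow> complex) \<Rightarrow> (complex \<Rightarrow> complex) \<Rightarrow> lax \<times> lax \<Rightarrow> lax \<times> lax \<Rightarrow> bool" where
  "gauge_related \<rho> \<sigma> P Q \<longleftrightarrow> (case P of (L, M) \<Rightarrow> case Q of (L', M') \<Rightarrow>
     (\<exists>(G :: int \<Rightarrow> int \<Rightarrow> complex^2^2) (c :: int \<Rightarrow> int \<Rightarrow> complex) (c' :: int \<Rightarrow> int \<Rightarrow> complex).
        (\<forall>i j. invertible (G i j) \<and> c i j \<noteq> 0 \<and> c' i j \<noteq> 0) \<and>
        (\<forall>i j. c' (i + 1) j * c i j = c i (j + 1) * c' i j) \<and>
        (\<forall>i j z. cmod z = 1 \<longrightarrow>
           L' i j (\<sigma> z) = mat (c i j) ** (G (i + 1) j ** L i j (\<rho> z) ** matrix_inv (G i j)) \<and>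
           M' i j (\<sigma> z) = mat (c' i j) ** (G i (j + 1) ** M i j (\<rho> z) ** matrix_inv (G i j)))))"

text \<open>
  A representation is the set of its solution pairs. The reparametrization is chosen once for the
  two representations, not separately for each solution pair.
\<close>

definition gauge_equivalent :: "(lax \<times> lax) set \<Rightarrow> (lax \<times> lax) set \<Rightarrow> bool" where
  "gauge_equivalent R S \<longleftrightarrow>
     (\<forall>(L, M) \<in> R. compatible L M) \<and> (\<forall>(L, M) \<in> S. compatible L M) \<and>
     (\<exists>\<rho> \<sigma>. reparametrization \<rho> \<and> reparametrization \<sigma> \<and>
        (\<forall>P \<in> R. \<exists>Q \<in> S. gauge_related \<rho> \<sigma> P Q) \<and>
        (\<forall>Q \<in> S. \<exists>P \<in> R. gauge_related \<sigma> \<rho> Q P))"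

section \<open>Cross-ratio systems and \<open>C\<^sup>+\<close> lattices\<close>

text \<open>
  In the index type \<open>4\<close> the directions are \<open>1, 2, 3, 4\<close>, where \<open>4 = 0\<close>. The value of \<open>\<alpha> i x\<close> is the
  label of the edge from \<open>x\<close> to \<open>x + ee i\<close>.
\<close>

definition ee :: "4 \<Rightarrow> int^4" where
  "ee i = axis i 1"

definition edge :: "(int^4 \<Rightarrow> complex) \<Rightarrow> 4 \<Rightarrow> int^4 \<Rightarrow> complex" where
  "edge f i x = f (x + ee i) - f x"

definition cross_ratio_system :: "(int^4 \<Rightarrow> complex) \<Rightarrow> (4 \<Rightarrow> int^4 \<Rightarrow> complex) \<Rightarrow> bool" where
  "cross_ratio_system f \<alpha> \<longleftrightarrow>
     (\<forall>i j x. i \<noteq> j \<longrightarrow> distinct [f x, f (x + ee i), f (x + ee j), f (x + ee i + ee j)]) \<and>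
     (\<forall>i x. \<alpha> i x \<noteq> 0) \<and>
     (\<forall>i j x. i \<noteq> j \<longrightarrow> \<alpha> i (x + ee j) = \<alpha> i x) \<and>
     (\<forall>i j x. i \<noteq> j \<longrightarrow>
        (edge f i x * edge f i (x + ee j)) / (edge f j x * edge f j (x + ee i))
          = (\<alpha> i x)\<^sup>2 / (\<alpha> j x)\<^sup>2)"

text \<open>
  As all edges of a cross-ratio system are nonzero, there is at most one such \<open>s\<close>; the cross-ratio
  equation gives its existence.
\<close>

definition is_s_map ::
    "(int^4 \<Rightarrow> complex) \<Rightarrow> (4 \<Rightarrow> int^4 \<Rightarrow> complex) \<Rightarrow> (int^4 \<Rightarrow> complex) \<Rightarrow> bool" where
  "is_s_map f \<alpha> s \<longleftrightarrow> s 0 = 1 \<and> (\<forall>i x. edge f i x = \<alpha> i x * s (x + ee i) * s x)"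

definition diag :: "int \<Rightarrow> int \<Rightarrow> int^4" where
  "diag i j = vector [i, j, i, j]"

definition C_plus_lattice :: "(int^4 \<Rightarrow> complex) \<Rightarrow> (4 \<Rightarrow> int^4 \<Rightarrow> complex) \<Rightarrow> bool" where
  "C_plus_lattice f \<alpha> \<longleftrightarrow> cross_ratio_system f \<alpha> \<and>
     (\<exists>s. is_s_map f \<alpha> s \<and>
       (\<forall>x \<in> range (case_prod diag).
          s (x + ee 1) * cnj (s (x + ee 3)) = 1 \<and> s (x + ee 2) * cnj (s (x + ee 4)) = 1 \<and>
          \<alpha> 1 x * cnj (\<alpha> 3 x) = -1 \<and> \<alpha> 2 x * cnj (\<alpha> 4 x) = -1))"

definition p_matrix ::
    "(int^4 \<Rightarrow> complex) \<Rightarrow> (4 \<Rightarrow> int^4 \<Rightarrow> complex) \<Rightarrow> 4 \<Rightarrow> int^4 \<Rightarrow> complex^2^2" where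
  "p_matrix f \<alpha> i x = mat2 0 (edge f i x) (- (\<alpha> i x)\<^sup>2 / edge f i x) 0"

text \<open>
  The matrix on the diagonal from \<open>x\<close> to \<open>x + ee i + ee k\<close>. The directions of \<open>\<int>\<^sup>2\<close> correspond to
  \<open>(i, k) = (1, 3)\<close> and \<open>(i, k) = (2, 4)\<close>.
\<close>

definition diagonal_matrix ::
    "(int^4 \<Rightarrow> complex) \<Rightarrow> (4 \<Rightarrow> int^4 \<Rightarrow> complex) \<Rightarrow> 4 \<Rightarrow> 4 \<Rightarrow> int^4 \<Rightarrow> complex \<Rightarrow> complex^2^2" where
  "diagonal_matrix f \<alpha> i k x z =
     (mat z + mat (1 / z) ** p_matrix f \<alpha> k (x + ee i)) ** (mat z + mat (1 / z) ** p_matrix f \<alpha> i x)"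

definition C_plus_representation :: "(lax \<times> lax) set" where
  "C_plus_representation = {(L, M). \<exists>f \<alpha>. C_plus_lattice f \<alpha> \<and>
     L = (\<lambda>i j. diagonal_matrix f \<alpha> 1 3 (diag i j)) \<and>
     M = (\<lambda>i j. diagonal_matrix f \<alpha> 2 4 (diag i j))}"

section \<open>The Lax representation of discrete cmc and constant Gaussian curvature nets\<close>

definition cmc_matrix :: "complex \<Rightarrow> complex \<Rightarrow> complex \<Rightarrow> complex^2^2" where
  "cmc_matrix a b z =
     mat2 a (z * b + 1 / (z * b)) (- cnj b / z - z / cnj b) (cnj a)"

text \<open>
  Nondegeneracy of a pair of fields \<open>L\<close>, \<open>M\<close> of such matrices, i.e. of the cross-ratio system that
  belongs to it. There are two parts.

  The first part is local: \<open>L\<close> and \<open>M\<close> at a vertex are not singular at a common nonzero spectral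
  parameter. It corresponds to distinct squared labels in the directions \<open>1, 3\<close> versus \<open>2, 4\<close>,
  hence to distinct opposite points of these quads. It excludes, for example, the
  solutions \<open>L = M\<close> depending on \<open>i + j\<close> only.

  The second part says that the evolution in \<open>\<int>\<^sup>4\<close> of the initial data read off from \<open>L\<close> along
  the first coordinate axis of \<open>\<int>\<^sup>2\<close> and from \<open>M\<close> along the second one stays nondegenerate. The
  data are found as follows. The factor \<open>w + 1 / w p\<^sup>1\<close> of the matrix on the diagonal of a cross-ratio
  system is singular for \<open>w\<^sup>2 = \<i> \<alpha>\<^sup>1\<close>, with kernel spanned by \<open>(s\<^sub>1 s, -\<i>)\<close>, and the diagonal
  can also be factorized with \<open>w + 1 / w p\<^sup>3\<close> on the right. After the substitution \<open>z = w\<^sup>2\<close> and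
  the gauge by the diagonal matrix with entries \<open>1 / sqrt s\<close>, \<open>sqrt s\<close>, followed by the rotation with the rows
  \<open>(0, 1)\<close>, \<open>(-1, 0)\<close> at the odd vertices (the constant entries of the cmc matrix are on the
  diagonal, those of the diagonal matrix off the diagonal), \<open>L\<close> is singular at
  \<open>z = \<i> \<alpha>\<^sup>k\<close>, \<open>k = 1, 3\<close>, with kernel spanned by \<open>(s\<^sub>k, -\<i>)\<close> at even and by \<open>(\<i>, s\<^sub>k)\<close> at odd
  vertices.

  A cmc matrix with nonzero \<open>a\<close> always has such data: its singular points are of the form
  \<open>\<plusminus>z, \<plusminus>1 / cnj z\<close>, so \<open>\<alpha>\<^sup>1 cnj \<alpha>\<^sup>3 = -1\<close> is a choice of signs. Only the values on the two
  axes enter, and the \<open>C\<^sup>+\<close> conditions on \<open>s\<close> are not required.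
\<close>

definition kernel_vector :: "int \<Rightarrow> complex \<Rightarrow> complex^2" where
  "kernel_vector n t = (if even n then vector [t, - \<i>] else vector [\<i>, t])"

definition initial_data ::
    "lax \<Rightarrow> lax \<Rightarrow> (4 \<Rightarrow> int^4 \<Rightarrow> complex) \<Rightarrow> (int^4 \<Rightarrow> complex) \<Rightarrow> bool" where
  "initial_data L M \<alpha> s \<longleftrightarrow>
     (\<forall>n. let x = diag n 0 in
        \<alpha> 1 x * cnj (\<alpha> 3 x) = -1 \<and>
        (\<forall>k \<in> {1, 3}. L n 0 (\<i> * \<alpha> k x) *v kernel_vector n (s (x + ee k)) = 0)) \<and>
     (\<forall>n. let x = diag 0 n in
        \<alpha> 2 x * cnj (\<alpha> 4 x) = -1 \<and>
        (\<forall>k \<in> {2, 4}. M 0 n (\<i> * \<alpha> k x) *v kernel_vector n (s (x + ee k)) = 0))"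

definition nondegenerate_solution :: "lax \<Rightarrow> lax \<Rightarrow> bool" where
  "nondegenerate_solution L M \<longleftrightarrow>
     (\<forall>i j z. z \<noteq> 0 \<longrightarrow> det (L i j z) \<noteq> 0 \<or> det (M i j z) \<noteq> 0) \<and>
     (\<exists>f \<alpha> s. cross_ratio_system f \<alpha> \<and> is_s_map f \<alpha> s \<and> initial_data L M \<alpha> s)"

definition cmc_representation :: "(lax \<times> lax) set" where
  "cmc_representation = {(L, M). \<exists>a b d e.
     (\<forall>i j. b i j \<noteq> 0 \<and> e i j \<noteq> 0) \<and>
     L = (\<lambda>i j. cmc_matrix (a i j) (b i j)) \<and> M = (\<lambda>i j. cmc_matrix (d i j) (e i j)) \<and>
     compatible L M \<and> nondegenerate_solution L M}"

end

theory Submission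
  imports Defs
begin

text \<open>
  On the diagonal net of a \<open>C\<^sup>+\<close> lattice the map \<open>s\<close> is positive, since the quad equation and the
  conditions on \<open>s\<close> and \<open>\<alpha>\<close> give \<open>s\<^sub>1\<^sub>3 (\<bar>\<alpha>\<^sup>1\<bar>\<^sup>2 + \<bar>s\<^sub>1\<bar>\<^sup>2) = s (1 + \<bar>\<alpha>\<^sup>1\<bar>\<^sup>2 \<bar>s\<^sub>1\<bar>\<^sup>2)\<close>. Hence one can gauge by the
  diagonal matrix with entries \<open>1 / sqrt s\<close>, \<open>sqrt s\<close>, and by a quarter rotation at the odd vertices.
  After division by the phase of the label this turns the diagonal matrices into cmc matrices in \<open>\<lambda>\<^sup>2\<close>.

  Conversely, a nondegenerate cmc solution provides a cross-ratio system through the kernels of its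
  matrices on the axes. The symmetry of cmc matrices under \<open>z \<mapsto> -1 / cnj z\<close> yields the \<open>C\<^sup>+\<close> conditions
  on the axes. They hold on the whole diagonal net, because the cross-ratio evolution commutes with
  the involution that exchanges the directions \<open>1, 3\<close> and \<open>2, 4\<close>, conjugates \<open>s\<close>, and inverts it at odd
  vertices. The cmc solution of the resulting lattice and the given one agree on the axes up to sign,
  and therefore everywhere: a cmc matrix is determined up to sign by a singular point and its kernel,
  and the kernels are transported along the cells of \<open>\<int>\<^sup>2\<close> by the compatibility condition.
\<close>

section \<open>Matrices and gauge transformations\<close>

lemma mat2_nth [simp]:
  "mat2 x y u v $ 1 $ 1 = x" "mat2 x y u v $ 1 $ 2 = y"
  "mat2 x y u v $ 2 $ 1 = u" "mat2 x y u v $ 2 $ 2 = v"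
  by (simp_all add: mat2_def)

lemma mat2_mult: "mat2 x y u v ** mat2 x' y' u' v' =
    mat2 (x * x' + y * u') (x * y' + y * v') (u * x' + v * u') (u * y' + v * v')"
  by (simp add: vec_eq_iff forall_2 matrix_matrix_mult_def sum_2)

lemma mat2_add: "mat2 x y u v + mat2 x' y' u' v' = mat2 (x + x') (y + y') (u + u') (v + v')"
  by (simp add: vec_eq_iff forall_2)

lemma mat_eq_mat2: "mat c = mat2 c 0 0 c"
  by (simp add: vec_eq_iff forall_2 mat_def)

lemma det_mat2: "det (mat2 x y u v) = x * v - y * u"
  by (simp add: det_2)

lemma mat2_vector: "mat2 x y u v *v vector [p, q] = vector [x * p + y * q, u * p + v * q]"
  by (simp add: vec_eq_iff forall_2 matrix_vector_mult_def sum_2)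

lemma mat2_eq_iff: "mat2 x y u v = mat2 x' y' u' v' \<longleftrightarrow> x = x' \<and> y = y' \<and> u = u' \<and> v = v'"
  by (auto simp: vec_eq_iff forall_2)

lemma transpose_mat2: "transpose (mat2 x y u v) = mat2 x u y v"
  by (simp add: vec_eq_iff forall_2 transpose_def)

lemma vector2_cases: obtains p q where "(w::complex^2) = vector [p, q]"
  by (rule that[of "w $ 1" "w $ 2"]) (simp add: vec_eq_iff forall_2)

lemma vector2_eq_0_iff: "(vector [p, q] :: complex^2) = 0 \<longleftrightarrow> p = 0 \<and> q = 0"
  by (simp add: vec_eq_iff forall_2)

lemma matrix_inv_unique:
  fixes A B :: "complex^'n^'n"
  assumes "A ** B = mat 1"
  shows "matrix_inv A = B"
proof -
  have BA: "B ** A = mat 1" using assms matrix_left_right_inverse by blast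
  then have "invertible A" using assms unfolding invertible_def by blast
  then have "A ** matrix_inv A = mat 1"
    unfolding invertible_def matrix_inv_def by (rule someI2_ex) blast
  then have "B ** (A ** matrix_inv A) = B" by simp
  then show ?thesis using BA by (simp add: matrix_mul_assoc)
qed

lemma det_0_imp_kernel:
  fixes A :: "complex^'n^'n"
  assumes "det A = 0"
  obtains v where "v \<noteq> 0" "A *v v = 0"
  using assms invertible_det_nz[of A] matrix_left_invertible_ker[of A]
  by (auto simp: invertible_left_inverse)

lemma det_nz_imp_kernel:
  fixes A :: "complex^'n^'n"
  assumes "det A \<noteq> 0" "A *v v = 0"
  shows "v = 0"
  using assms invertible_det_nz[of A] matrix_left_invertible_ker[of A]
  by (auto simp: invertible_left_inverse)

lemma mat_scalar_mult_commute:
  fixes A :: "complex^'n^'n"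
  shows "mat c ** A = A ** mat c"
  by (simp add: vec_eq_iff matrix_matrix_mult_def mat_def if_distrib if_distribR cong: if_cong)

text \<open>The inverse gauge with reciprocal scalars undoes the transformation. Each pair is
  evaluated through its own reparametrization, so \<open>\<rho>\<close> and \<open>\<sigma>\<close>
  trade places and neither has to be inverted.\<close>

lemma gauge_related_sym:
  assumes "gauge_related \<rho> \<sigma> P Q"
  shows "gauge_related \<sigma> \<rho> Q P"
proof -
  obtain L M L' M' where PQ: "P = (L, M)" "Q = (L', M')" by (cases P, cases Q)
  obtain G c c' where inv: "\<And>i j. invertible (G i j) \<and> c i j \<noteq> 0 \<and> c' i j \<noteq> 0"
    and cc: "\<And>i j. c' (i + 1) j * c i j = c i (j + 1) * c' i j"
    and L: "\<And>i j z. cmod z = 1 \<Longrightarrow> L' i j (\<sigma> z) = mat (c i j) ** (G (i + 1) j ** L i j (\<rho> z) ** matrix_inv (G i j))"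
    and M: "\<And>i j z. cmod z = 1 \<Longrightarrow> M' i j (\<sigma> z) = mat (c' i j) ** (G i (j + 1) ** M i j (\<rho> z) ** matrix_inv (G i j))"
    using assms unfolding gauge_related_def PQ split by blast
  define H where "H i j = matrix_inv (G i j)" for i j
  have GH: "G i j ** H i j = mat 1" "H i j ** G i j = mat 1" for i j
    using inv[of i j] matrix_inv_unique[of "G i j"] unfolding H_def invertible_def by auto
  have Hinv: "matrix_inv (H i j) = G i j" for i j
    using GH(2) by (rule matrix_inv_unique)
  have undo: "X = mat (1 / k) ** (H' ** (mat k ** (G' ** X ** H0)) ** G0)"
    if "k \<noteq> 0" "H' ** G' = mat 1" "H0 ** G0 = mat 1" for k and X H' G' H0 G0 :: "complex^2^2"
  proof -
    have "mat (1 / k) ** (H' ** (mat k ** (G' ** X ** H0)) ** G0) =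
        (mat (1 / k) ** mat k) ** ((H' ** G') ** X ** (H0 ** G0))"
      by (metis (no_types) mat_scalar_mult_commute matrix_mul_assoc)
    also have "mat (1 / k) ** mat k = (mat 1 :: complex^2^2)"
      using that(1) by (simp add: mat_eq_mat2 mat2_mult)
    finally show ?thesis using that by simp
  qed
  show ?thesis
    unfolding gauge_related_def PQ split
  proof (rule exI[of _ H], rule exI[of _ "\<lambda>i j. 1 / c i j"], rule exI[of _ "\<lambda>i j. 1 / c' i j"],
      intro conjI allI impI)
    fix i j
    show "invertible (H i j)" unfolding invertible_def using GH by blast
    show "1 / c i j \<noteq> 0" "1 / c' i j \<noteq> 0" using inv by auto
    show "1 / c' (i + 1) j * (1 / c i j) = 1 / c i (j + 1) * (1 / c' i j)"
      using cc[of i j] by simp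
  next
    fix i j and z :: complex assume z: "cmod z = 1"
    show "L i j (\<rho> z) = mat (1 / c i j) ** (H (i + 1) j ** L' i j (\<sigma> z) ** matrix_inv (H i j))"
      unfolding L[OF z] Hinv H_def[symmetric] using undo inv GH by metis
    show "M i j (\<rho> z) = mat (1 / c' i j) ** (H i (j + 1) ** M' i j (\<sigma> z) ** matrix_inv (H i j))"
      unfolding M[OF z] Hinv H_def[symmetric] using undo inv GH by metis
  qed
qed

text \<open>The sign is chosen before \<open>z\<close>: one constant for the whole matrix function.
  This is the freedom that a singular point with its kernel leaves in a cmc matrix.\<close>

definition sign_eq :: "(complex \<Rightarrow> complex^2^2) \<Rightarrow> (complex \<Rightarrow> complex^2^2) \<Rightarrow> bool" where
  "sign_eq X Y \<longleftrightarrow> (\<exists>e. (e = 1 \<or> e = -1) \<and> (\<forall>z. X z = mat e ** Y z))"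

definition cmc_fun :: "(complex \<Rightarrow> complex^2^2) \<Rightarrow> bool" where
  "cmc_fun X \<longleftrightarrow> (\<exists>a b. b \<noteq> 0 \<and> X = cmc_matrix a b)"

lemma sign_eq_sym: "sign_eq X Y \<Longrightarrow> sign_eq Y X"
proof -
  assume "sign_eq X Y"
  then obtain e where e: "e = 1 \<or> e = -1" "\<And>z. X z = mat e ** Y z" unfolding sign_eq_def by auto
  have "mat e ** X z = Y z" for z
    using e by (auto simp: matrix_mul_assoc mat_eq_mat2 mat2_mult) (auto simp flip: mat_eq_mat2)
  then show ?thesis using e(1) unfolding sign_eq_def by metis
qed

lemma sign_eq_transpose: "sign_eq X Y \<Longrightarrow> sign_eq (\<lambda>z. transpose (X z)) (\<lambda>z. transpose (Y z))"
  unfolding sign_eq_def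
  by (auto simp: matrix_transpose_mul mat_scalar_mult_commute)

lemma sign_eq_mult_vec_0_iff:
  assumes "sign_eq X Y"
  shows "X z *v v = 0 \<longleftrightarrow> Y z *v v = 0"
proof -
  have "mat (-1) *v u = - u" for u :: "complex^2"
    by (simp add: vec_eq_iff matrix_vector_mult_def mat_def if_distrib if_distribR cong: if_cong)
  with assms show ?thesis
    unfolding sign_eq_def by (auto simp flip: matrix_vector_mul_assoc)
qed

lemma sign_eq_det:
  assumes "sign_eq X Y"
  shows "det (X z) = det (Y z)"
  using assms unfolding sign_eq_def
  by (auto simp: det_mul mat_eq_mat2 det_mat2)

section \<open>The cmc matrices\<close>

lemma cmc_matrix_uminus: "cmc_matrix (-a) (-b) z = mat (-1) ** cmc_matrix a b z"
  by (simp add: cmc_matrix_def mat_eq_mat2 mat2_mult mat2_eq_iff)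

lemma det_cmc_matrix:
  "det (cmc_matrix a b z) = a * cnj a + (z * b + 1 / (z * b)) * (cnj b / z + z / cnj b)"
  by (simp add: cmc_matrix_def det_mat2 algebra_simps)

text \<open>Replacing \<open>b\<close> by \<open>- 1 / cnj b\<close> exchanges the two off-diagonal
  entries. In this way statements about kernels become available for left kernels.\<close>

lemma cmc_fun_transpose:
  assumes "cmc_fun X"
  shows "cmc_fun (\<lambda>z. transpose (X z))"
proof -
  obtain a b where ab: "b \<noteq> 0" "X = cmc_matrix a b" using assms unfolding cmc_fun_def by blast
  then have "(\<lambda>z. transpose (X z)) = cmc_matrix a (- 1 / cnj b)"
    by (auto simp: fun_eq_iff cmc_matrix_def transpose_mat2 mat2_eq_iff)
  with ab(1) show ?thesis unfolding cmc_fun_def by (metis complex_cnj_zero_iff divide_eq_0_iff neg_equal_0_iff_equal zero_neq_one)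
qed

text \<open>The first row gives \<open>a * p\<close>, the conjugate of the second row gives
  \<open>a * cnj q\<close>. Computing \<open>a * p * cnj q\<close> in both ways eliminates
  \<open>a\<close>, and \<open>b\<close> remains only through its square.\<close>

lemma cmc_matrix_kernel_square:
  assumes b: "b \<noteq> 0" and z: "z \<noteq> 0" and k: "cmc_matrix a b z *v vector [p, q] = 0"
  shows "b\<^sup>2 * (z * (cmod (z * q) ^ 2 + cmod p ^ 2)) = - (cnj z * (cmod q ^ 2 + cmod (z * p) ^ 2))"
proof -
  have "a * p + (z * b + 1 / (z * b)) * q = 0"
    using k by (simp add: cmc_matrix_def mat2_vector vector2_eq_0_iff)
  then have 1: "a * p = - (z * b + 1 / (z * b)) * q"
    by (simp only: eq_neg_iff_add_eq_0 minus_mult_left[symmetric])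
  have "(- cnj b / z - z / cnj b) * p + cnj a * q = 0"
    using k by (simp add: cmc_matrix_def mat2_vector vector2_eq_0_iff)
  then have "cnj ((- cnj b / z - z / cnj b) * p + cnj a * q) = 0" by (simp only: complex_cnj_zero)
  then have 2: "a * cnj q = (b / cnj z + cnj z / b) * cnj p"
    by (simp add: algebra_simps eq_neg_iff_add_eq_0)
  have "- (z * b + 1 / (z * b)) * q * cnj q = (b / cnj z + cnj z / b) * cnj p * p"
  proof -
    have "(a * p) * cnj q = (a * cnj q) * p" by simp
    then show ?thesis unfolding 1 2 .
  qed
  then have "(b * z * cnj z * - (z * b + 1 / (z * b))) * (q * cnj q) =
      (b * z * cnj z * (b / cnj z + cnj z / b)) * (cnj p * p)"
    by (simp only: mult.assoc)
  moreover have "b * z * cnj z * - (z * b + 1 / (z * b)) = - (z * cnj z * b\<^sup>2 * z + cnj z)"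
    "b * z * cnj z * (b / cnj z + cnj z / b) = b\<^sup>2 * z + cnj z * (z * cnj z)"
    using b z by (simp_all add: field_simps power2_eq_square)
  ultimately have "- (z * cnj z * b\<^sup>2 * z + cnj z) * (q * cnj q) = (b\<^sup>2 * z + cnj z * (z * cnj z)) * (cnj p * p)"
    by simp
  moreover have "complex_of_real (cmod u) ^ 2 = u * cnj u" for u
    by (metis complex_norm_square of_real_power)
  ultimately show ?thesis
    unfolding complex_cnj_mult by (simp add: algebra_simps power2_eq_square)
qed

text \<open>The coefficient of \<open>b\<^sup>2\<close> in the equation freed from \<open>a\<close>
  is nonzero, so \<open>b\<close> is known up to sign. For fixed \<open>b\<close> the kernel
  equations then give \<open>a\<close>, by whichever component of \<open>w\<close> is
  nonzero.\<close>

lemma cmc_fun_sign_eq: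
  assumes "cmc_fun X" "cmc_fun Y" and z: "z \<noteq> 0" and w: "w \<noteq> 0"
    and X: "X z *v w = 0" and Y: "Y z *v w = 0"
  shows "sign_eq X Y"
proof -
  obtain a b where ab: "b \<noteq> 0" "X = cmc_matrix a b" using assms(1) unfolding cmc_fun_def by blast
  obtain a' b' where ab': "b' \<noteq> 0" "Y = cmc_matrix a' b'" using assms(2) unfolding cmc_fun_def by blast
  obtain p q where pq: "w = vector [p, q]" by (rule vector2_cases)
  then have pq0: "p \<noteq> 0 \<or> q \<noteq> 0" using w by (auto simp: vector2_eq_0_iff)
  define A where "A = z * (complex_of_real (cmod (z * q)) ^ 2 + complex_of_real (cmod p) ^ 2)"
  have "(cmod (z * q))\<^sup>2 + (cmod p)\<^sup>2 > 0"
    using pq0 z by (auto simp: sum_power2_gt_zero_iff)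
  then have "complex_of_real ((cmod (z * q))\<^sup>2 + (cmod p)\<^sup>2) \<noteq> 0"
    unfolding of_real_eq_0_iff by (rule less_imp_neq[symmetric])
  then have "A \<noteq> 0" unfolding A_def of_real_add of_real_power using z by (simp only: mult_eq_0_iff) simp
  moreover have "b\<^sup>2 * A = b'\<^sup>2 * A"
    using cmc_matrix_kernel_square[of b z a p q] cmc_matrix_kernel_square[of b' z a' p q]
    using ab ab' X Y pq z unfolding A_def by simp
  ultimately have "b\<^sup>2 = b'\<^sup>2" by simp
  then have cases: "b = b' \<or> b = - b'" by (simp add: power2_eq_iff)
  have main: "a = a''" if "cmc_matrix a b z *v w = 0" "cmc_matrix a'' b z *v w = 0" for a''
  proof -
    define g where "g = (- cnj b / z - z / cnj b) * p"
    have "a * p = a'' * p" "g + cnj a * q = 0" "g + cnj a'' * q = 0"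
      using that unfolding pq g_def cmc_matrix_def mat2_vector vector2_eq_0_iff
      by (metis add_right_cancel, blast+)
    then have "a * p = a'' * p" "cnj a * q = cnj a'' * q" by (metis add_left_cancel)+
    then show ?thesis using pq0 by auto
  qed
  show ?thesis
  proof (cases "b = b'")
    case True
    then have "X = Y" using main[of a'] ab ab' X Y by simp
    then show ?thesis unfolding sign_eq_def by (intro exI[of _ 1]) simp
  next
    case False
    with cases have b': "b = - b'" by simp
    have "cmc_matrix (- a') b z *v w = mat (- 1) *v (Y z *v w)"
      unfolding b' cmc_matrix_uminus ab' by (simp add: matrix_vector_mul_assoc)
    then have "cmc_matrix (- a') b z *v w = 0" using Y by simp
    then have "a = - a'" using main[of "- a'"] ab X by simp
    then have "X z = mat (-1) ** Y z" for z using ab ab' b' cmc_matrix_uminus by simp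
    then show ?thesis unfolding sign_eq_def by blast
  qed
qed

section \<open>Determinants and products of cmc matrices as Laurent polynomials\<close>

lemma quadratic_three_roots:
  fixes p q r x y w :: complex
  assumes "p * x\<^sup>2 + q * x + r = 0" "p * y\<^sup>2 + q * y + r = 0" "p * w\<^sup>2 + q * w + r = 0"
    and "x \<noteq> y" "x \<noteq> w" "y \<noteq> w"
  shows "p = 0"
proof -
  have "(x - y) * (p * (x + y) + q) = 0" "(x - w) * (p * (x + w) + q) = 0"
  proof -
    have "(x - y) * (p * (x + y) + q) = (p * x\<^sup>2 + q * x + r) - (p * y\<^sup>2 + q * y + r)"
      by (simp add: algebra_simps power2_eq_square)
    then show "(x - y) * (p * (x + y) + q) = 0" using assms by simp
    have "(x - w) * (p * (x + w) + q) = (p * x\<^sup>2 + q * x + r) - (p * w\<^sup>2 + q * w + r)"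
      by (simp add: algebra_simps power2_eq_square)
    then show "(x - w) * (p * (x + w) + q) = 0" using assms by simp
  qed
  then have "p * (x + y) + q = 0" "p * (x + w) + q = 0" using assms by auto
  then have "(p * (x + y) + q) - (p * (x + w) + q) = 0" by simp
  then have "p * (y - w) = 0" by (simp add: algebra_simps)
  then show ?thesis using assms by simp
qed

text \<open>\<open>w\<^sup>2 * det (X w)\<close> is a quadratic polynomial in
  \<open>w\<^sup>2\<close> with leading coefficient \<open>b / cnj b\<close>, which a third root
  would force to vanish.\<close>

lemma cmc_fun_det_roots:
  assumes "cmc_fun X" "x \<noteq> 0" "y \<noteq> 0" "z \<noteq> 0" "x\<^sup>2 \<noteq> y\<^sup>2" "x\<^sup>2 \<noteq> z\<^sup>2" "y\<^sup>2 \<noteq> z\<^sup>2"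
    and "det (X x) = 0" "det (X y) = 0"
  shows "det (X z) \<noteq> 0"
proof
  assume "det (X z) = 0"
  obtain a b where ab: "b \<noteq> 0" "X = cmc_matrix a b" using assms(1) unfolding cmc_fun_def by blast
  have *: "b / cnj b * (w\<^sup>2)\<^sup>2 + (a * cnj a + b * cnj b + 1 / (b * cnj b)) * w\<^sup>2 + cnj b / b = 0"
    if "w \<noteq> 0" "det (X w) = 0" for w
  proof -
    have "b / cnj b * (w\<^sup>2)\<^sup>2 + (a * cnj a + b * cnj b + 1 / (b * cnj b)) * w\<^sup>2 + cnj b / b = w\<^sup>2 * det (X w)"
      unfolding ab(2) det_cmc_matrix using ab(1) that(1) by (simp add: field_simps power2_eq_square)
    then show ?thesis using that by simp
  qed
  have "b / cnj b = 0"
    by (rule quadratic_three_roots[OF *[of x] *[of y] *[of z]]) (use assms \<open>det (X z) = 0\<close> in auto)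
  then show False using ab(1) by simp
qed

lemma laurent_odd_zero:
  assumes "\<And>z. cmod z = 1 \<Longrightarrow> p * z + q / z = 0"
  shows "p = 0 \<and> q = 0"
proof -
  have "p + q = 0" "p = q" using assms[of 1] assms[of \<i>] by (simp_all flip: distrib_left add: mult.commute)
  then show ?thesis by simp
qed

lemma laurent_even_zero:
  assumes "\<And>z. cmod z = 1 \<Longrightarrow> p * z\<^sup>2 + q + r / z\<^sup>2 = 0"
  shows "p = 0 \<and> q = 0 \<and> r = 0"
proof -
  have 1: "p + q + r = 0" "q - p - r = 0" using assms[of 1] assms[of \<i>] by (simp_all add: algebra_simps)
  \<comment> \<open>At \<open>1\<close> and \<open>\<i>\<close> the values of
    \<open>z\<^sup>2\<close> and \<open>1 / z\<^sup>2\<close> coincide, so a square root of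
    \<open>\<i>\<close> is taken as third sample point to separate \<open>p\<close> from
    \<open>r\<close>.\<close>
  have c: "cmod (csqrt \<i>) = 1" by (simp only: norm_csqrt norm_ii real_sqrt_one)
  have "p * \<i> + q + r / \<i> = 0" using assms[OF c] by (simp only: power2_csqrt)
  then have 2: "(p - r) * \<i> + q = 0" by (simp add: algebra_simps)
  have "q = 0" using 1 by algebra
  then show ?thesis using 1 2 by (auto simp: add_eq_0_iff)
qed

lemma laurent_even_extend:
  fixes a b p q r s p' q' r' s' z :: complex
  assumes eq: "\<And>z. cmod z = 1 \<Longrightarrow>
      a + (p * z + q / z) * (r * z + s / z) = b + (p' * z + q' / z) * (r' * z + s' / z)"
    and z: "z \<noteq> 0"
  shows "a + (p * z + q / z) * (r * z + s / z) = b + (p' * z + q' / z) * (r' * z + s' / z)"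
proof -
  have expand: "(p * z + q / z) * (r * z + s / z) = p * r * z\<^sup>2 + (p * s + q * r) + q * s / z\<^sup>2"
    if "z \<noteq> 0" for p q r s z :: complex
    using that by (simp add: field_simps power2_eq_square)
  have collect: "a + (p * z + q / z) * (r * z + s / z) - (b + (p' * z + q' / z) * (r' * z + s' / z)) =
      (p * r - p' * r') * z\<^sup>2 + (a + p * s + q * r - b - p' * s' - q' * r') + (q * s - q' * s') / z\<^sup>2"
    if "z \<noteq> 0" for z
    unfolding expand[OF that] by (simp add: left_diff_distrib diff_divide_distrib)
  have "p * r - p' * r' = 0 \<and> a + p * s + q * r - b - p' * s' - q' * r' = 0 \<and> q * s - q' * s' = 0"
  proof (rule laurent_even_zero)
    fix z :: complex assume "cmod z = 1"
    moreover from this have "z \<noteq> 0" by auto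
    ultimately show "(p * r - p' * r') * z\<^sup>2 + (a + p * s + q * r - b - p' * s' - q' * r') +
        (q * s - q' * s') / z\<^sup>2 = 0"
      using collect[of z] eq[of z] by simp
  qed
  then show ?thesis using collect[OF z] by simp
qed

lemma laurent_odd_extend:
  fixes a b d d' p q r s p' q' r' s' z :: complex
  assumes eq: "\<And>z. cmod z = 1 \<Longrightarrow>
      a * (p * z + q / z) + (r * z + s / z) * d = b * (p' * z + q' / z) + (r' * z + s' / z) * d'"
    and z: "z \<noteq> 0"
  shows "a * (p * z + q / z) + (r * z + s / z) * d = b * (p' * z + q' / z) + (r' * z + s' / z) * d'"
proof -
  have collect: "a * (p * z + q / z) + (r * z + s / z) * d - (b * (p' * z + q' / z) + (r' * z + s' / z) * d') =
      (a * p + r * d - b * p' - r' * d') * z + (a * q + s * d - b * q' - s' * d') / z" for z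
    by (simp add: distrib_left distrib_right left_diff_distrib diff_divide_distrib add_divide_distrib)
  have "a * p + r * d - b * p' - r' * d' = 0 \<and> a * q + s * d - b * q' - s' * d' = 0"
    by (rule laurent_odd_zero) (use collect eq in \<open>metis right_minus_eq\<close>)
  then show ?thesis using collect[of z] by simp
qed

text \<open>Compatibility is given on the unit circle, whereas kernels are taken at singular points
  that may lie off it. All entries of the products are Laurent polynomials in \<open>z\<close>, and
  their coefficients are determined by the circle.\<close>

lemma cmc_fun_compatible_extend:
  assumes "cmc_fun X" "cmc_fun Y" "cmc_fun X'" "cmc_fun Y'"
    and circle: "\<And>z. cmod z = 1 \<Longrightarrow> X z ** Y z = X' z ** Y' z" and z: "z \<noteq> 0"
  shows "X z ** Y z = X' z ** Y' z"
proof -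
  have form: "\<exists>a p q r s d. \<forall>z. F z = mat2 a (p * z + q / z) (r * z + s / z) d" if F: "cmc_fun F" for F
  proof -
    obtain a b where "F = cmc_matrix a b" using F unfolding cmc_fun_def by blast
    then have "\<forall>z. F z = mat2 a (b * z + (1 / b) / z) ((- 1 / cnj b) * z + (- cnj b) / z) (cnj a)"
      by (simp add: cmc_matrix_def mat2_eq_iff mult.commute)
    then show ?thesis by (intro exI)
  qed
  obtain a p q r s d where X: "\<forall>z. X z = mat2 a (p * z + q / z) (r * z + s / z) d"
    using form[OF assms(1)] by (elim exE)
  obtain a2 p2 q2 r2 s2 d2 where Y: "\<forall>z. Y z = mat2 a2 (p2 * z + q2 / z) (r2 * z + s2 / z) d2"
    using form[OF assms(2)] by (elim exE)
  obtain a3 p3 q3 r3 s3 d3 where X': "\<forall>z. X' z = mat2 a3 (p3 * z + q3 / z) (r3 * z + s3 / z) d3"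
    using form[OF assms(3)] by (elim exE)
  obtain a4 p4 q4 r4 s4 d4 where Y': "\<forall>z. Y' z = mat2 a4 (p4 * z + q4 / z) (r4 * z + s4 / z) d4"
    using form[OF assms(4)] by (elim exE)
  note X = X[rule_format] note Y = Y[rule_format] note X' = X'[rule_format] note Y' = Y'[rule_format]
  note circle' = circle[unfolded X Y X' Y' mat2_mult mat2_eq_iff]
  show ?thesis
    unfolding X Y X' Y' mat2_mult mat2_eq_iff
  proof (intro conjI)
    show "a * a2 + (p * z + q / z) * (r2 * z + s2 / z) = a3 * a4 + (p3 * z + q3 / z) * (r4 * z + s4 / z)"
      by (rule laurent_even_extend[OF _ z]) (rule conjunct1[OF circle'])
    show "a * (p2 * z + q2 / z) + (p * z + q / z) * d2 = a3 * (p4 * z + q4 / z) + (p3 * z + q3 / z) * d4"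
      by (rule laurent_odd_extend[OF _ z]) (rule conjunct1[OF conjunct2[OF circle']])
    have "d * (r2 * z + s2 / z) + (r * z + s / z) * a2 = d3 * (r4 * z + s4 / z) + (r3 * z + s3 / z) * a4"
      by (rule laurent_odd_extend[OF _ z], subst (1 2) add.commute)
         (rule conjunct1[OF conjunct2[OF conjunct2[OF circle']]])
    then show "(r * z + s / z) * a2 + d * (r2 * z + s2 / z) = (r3 * z + s3 / z) * a4 + d3 * (r4 * z + s4 / z)"
      by (simp only: add.commute)
    have "d * d2 + (r * z + s / z) * (p2 * z + q2 / z) = d3 * d4 + (r3 * z + s3 / z) * (p4 * z + q4 / z)"
      by (rule laurent_even_extend[OF _ z], subst (1 2) add.commute)
         (rule conjunct2[OF conjunct2[OF conjunct2[OF circle']]])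
    then show "(r * z + s / z) * (p2 * z + q2 / z) + d * d2 = (r3 * z + s3 / z) * (p4 * z + q4 / z) + d3 * d4"
      by (simp only: add.commute)
  qed
qed

section \<open>A solution is determined by its values on the axes\<close>

lemma sign_eq_mult_vec:
  assumes "sign_eq Y Y'"
  shows "X *v (Y z *v v) = 0 \<longleftrightarrow> X *v (Y' z *v v) = 0"
proof -
  have neg: "mat (-1) *v u = - u" "X *v - u = - (X *v u)" for u :: "complex^2"
    by (simp_all add: vec_eq_iff forall_2 matrix_vector_mult_def sum_2 mat_def)
  obtain e where e: "e = 1 \<or> e = -1" "Y z = mat e ** Y' z"
    using assms unfolding sign_eq_def by blast
  from e(1) show ?thesis
  proof
    assume "e = 1"
    then show ?thesis using e(2) by simp
  next
    assume "e = -1"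
    then have "Y z *v v = - (Y' z *v v)" using e(2) by (simp add: neg flip: matrix_vector_mul_assoc)
    then show ?thesis by (simp add: neg)
  qed
qed

text \<open>In a cell \<open>N ** L = X ** M\<close> the matrix \<open>M z\<close> maps the kernel
  of \<open>L z\<close> into that of \<open>X z\<close>, and the image is nonzero where
  \<open>M' z\<close> is regular. Hence \<open>X z\<close> and \<open>X' z\<close> annihilate a
  common nonzero vector.\<close>

lemma transport_top:
  fixes N N' :: "complex^2^2"
  assumes "cmc_fun X" "cmc_fun X'" "sign_eq L L'" "sign_eq M M'" "z \<noteq> 0"
    and cell: "N ** L z = X z ** M z" "N' ** L' z = X' z ** M' z"
    and "det (L' z) = 0" "det (M' z) \<noteq> 0"
  shows "sign_eq X X'"
proof -
  obtain v where v: "v \<noteq> 0" "L' z *v v = 0" using det_0_imp_kernel[OF assms(8)] by blast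
  have Lv: "L z *v v = 0" using v sign_eq_mult_vec_0_iff[OF assms(3)] by simp
  have w: "M' z *v v \<noteq> 0" using det_nz_imp_kernel[OF assms(9)] v(1) by blast
  have "X' z *v (M' z *v v) = N' *v (L' z *v v)"
    by (simp only: matrix_vector_mul_assoc cell)
  then have X': "X' z *v (M' z *v v) = 0" using v(2) by simp
  have "X z *v (M z *v v) = N *v (L z *v v)"
    by (simp only: matrix_vector_mul_assoc cell)
  then have "X z *v (M z *v v) = 0" using Lv by simp
  then have "X z *v (M' z *v v) = 0" by (rule sign_eq_mult_vec[OF assms(4), THEN iffD1])
  then show ?thesis using cmc_fun_sign_eq[OF assms(1,2,5) w] X' by simp
qed

text \<open>Here the cell is used backwards: regularity of \<open>N'\<close> makes
  \<open>L' z\<close> singular, and regularity of \<open>N\<close> lets a kernel vector of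
  \<open>L' z\<close>, seen through \<open>X z ** M z\<close>, return to the kernel of
  \<open>L z\<close>.\<close>

lemma transport_bottom:
  fixes N N' :: "complex^2^2"
  assumes "cmc_fun L" "cmc_fun L'" "sign_eq X X'" "sign_eq M M'" "z \<noteq> 0"
    and cell: "N ** L z = X z ** M z" "N' ** L' z = X' z ** M' z"
    and "det (X' z) = 0" "det N \<noteq> 0" "det N' \<noteq> 0"
  shows "sign_eq L L'"
proof -
  have "det N' * det (L' z) = 0"
    using arg_cong[OF cell(2), of det] assms(8) by (simp add: det_mul)
  then have "det (L' z) = 0" using assms(10) by simp
  then obtain v where v: "v \<noteq> 0" "L' z *v v = 0" using det_0_imp_kernel by blast
  have "X' z *v (M' z *v v) = N' *v (L' z *v v)"
    by (simp only: matrix_vector_mul_assoc cell)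
  then have "X' z *v (M' z *v v) = 0" using v(2) by simp
  then have "X z *v (M' z *v v) = 0" using sign_eq_mult_vec_0_iff[OF assms(3)] by blast
  then have "X z *v (M z *v v) = 0" by (rule sign_eq_mult_vec[OF assms(4), THEN iffD2])
  moreover have "N *v (L z *v v) = X z *v (M z *v v)"
    by (simp only: matrix_vector_mul_assoc cell)
  ultimately have "L z *v v = 0" using det_nz_imp_kernel[OF assms(9)] by simp
  then show ?thesis using cmc_fun_sign_eq[OF assms(1,2,5) v(1)] v(2) by simp
qed

text \<open>The known edges meet at the far corner of the cell, so left kernels are transported
  instead. Transposing the cell reduces this to \<open>transport_top\<close>.\<close>

lemma transport_corner:
  assumes "cmc_fun L" "cmc_fun L'" "sign_eq X X'" "sign_eq N N'" "z \<noteq> 0"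
    and cell: "N z ** L z = X z ** M" "N' z ** L' z = X' z ** M'"
    and "det (X' z) = 0" "det (N' z) \<noteq> 0"
  shows "sign_eq L L'"
proof -
  have "sign_eq (\<lambda>z. transpose (L z)) (\<lambda>z. transpose (L' z))"
  proof (rule transport_top[OF cmc_fun_transpose[OF assms(1)] cmc_fun_transpose[OF assms(2)]
          sign_eq_transpose[OF assms(3)] sign_eq_transpose[OF assms(4)] assms(5)])
    show "transpose M ** transpose (X z) = transpose (L z) ** transpose (N z)"
      "transpose M' ** transpose (X' z) = transpose (L' z) ** transpose (N' z)"
      using cell by (simp_all flip: matrix_transpose_mul)
  qed (use assms in simp_all)
  then show ?thesis using sign_eq_transpose by fastforce
qed

text \<open>The singular points of the primed pair are known, and each depends on one coordinate
  only. For the unprimed pair it is only assumed that the two determinants at a vertex have no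
  common root; its singular points are found while agreement spreads.\<close>

locale cmc_pair_comparison =
  fixes L M L' M' :: lax and x x' y y' :: "int \<Rightarrow> complex"
  assumes cmc: "\<And>i j. cmc_fun (L i j)" "\<And>i j. cmc_fun (M i j)"
      "\<And>i j. cmc_fun (L' i j)" "\<And>i j. cmc_fun (M' i j)"
    and compatible: "compatible L M" "compatible L' M'"
    and no_common_root: "\<And>i j z. z \<noteq> 0 \<Longrightarrow> det (L i j z) \<noteq> 0 \<or> det (M i j z) \<noteq> 0"
    and roots_L': "\<And>i j z. z \<noteq> 0 \<Longrightarrow> det (L' i j z) = 0 \<longleftrightarrow> z\<^sup>2 = (x i)\<^sup>2 \<or> z\<^sup>2 = (x' i)\<^sup>2"
    and roots_M': "\<And>i j z. z \<noteq> 0 \<Longrightarrow> det (M' i j z) = 0 \<longleftrightarrow> z\<^sup>2 = (y j)\<^sup>2 \<or> z\<^sup>2 = (y' j)\<^sup>2"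
    and nonzero: "\<And>i. x i \<noteq> 0" "\<And>i. x' i \<noteq> 0" "\<And>j. y j \<noteq> 0" "\<And>j. y' j \<noteq> 0"
    and separated: "\<And>i. (x i)\<^sup>2 \<noteq> (x' i)\<^sup>2" "\<And>j. (y j)\<^sup>2 \<noteq> (y' j)\<^sup>2"
      "\<And>i j. (x i)\<^sup>2 \<noteq> (y j)\<^sup>2" "\<And>i j. (x i)\<^sup>2 \<noteq> (y' j)\<^sup>2"
      "\<And>i j. (x' i)\<^sup>2 \<noteq> (y j)\<^sup>2" "\<And>i j. (x' i)\<^sup>2 \<noteq> (y' j)\<^sup>2"
begin

abbreviation agree_L :: "int \<Rightarrow> int \<Rightarrow> bool" where "agree_L i j \<equiv> sign_eq (L i j) (L' i j)"
abbreviation agree_M :: "int \<Rightarrow> int \<Rightarrow> bool" where "agree_M i j \<equiv> sign_eq (M i j) (M' i j)"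

lemma cell:
  assumes "z \<noteq> 0"
  shows "M (i + 1) j z ** L i j z = L i (j + 1) z ** M i j z"
    and "M' (i + 1) j z ** L' i j z = L' i (j + 1) z ** M' i j z"
  by (rule cmc_fun_compatible_extend[OF cmc(2,1) cmc(1,2) _ assms],
      use compatible(1) in \<open>simp add: compatible_def\<close>,
      rule cmc_fun_compatible_extend[OF cmc(4,3) cmc(3,4) _ assms],
      use compatible(2) in \<open>simp add: compatible_def\<close>)

lemma det_at_roots:
  "det (L' i j (x i)) = 0" "det (L' i j (x' i)) = 0" "det (M' i j (y j)) = 0" "det (M' i j (y' j)) = 0"
  "det (M' i j (x k)) \<noteq> 0" "det (M' i j (x' k)) \<noteq> 0" "det (L' i j (y k)) \<noteq> 0" "det (L' i j (y' k)) \<noteq> 0"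
  by (simp_all add: roots_L' roots_M' nonzero separated separated[symmetric])

lemma agree_top: "agree_L i j \<Longrightarrow> agree_M i j \<Longrightarrow> agree_L i (j + 1)"
  by (rule transport_top[where z = "x i" and L = "L i j" and L' = "L' i j" and M = "M i j" and M' = "M' i j"
        and N = "M (i + 1) j (x i)" and N' = "M' (i + 1) j (x i)"])
     (simp_all add: cmc nonzero det_at_roots cell)

lemma agree_right: "agree_L i j \<Longrightarrow> agree_M i j \<Longrightarrow> agree_M (i + 1) j"
  by (rule transport_top[where z = "y j" and L = "M i j" and L' = "M' i j" and M = "L i j" and M' = "L' i j"
        and N = "L i (j + 1) (y j)" and N' = "L' i (j + 1) (y j)"])
     (simp_all add: cmc nonzero det_at_roots cell)

lemma agree_corner: "agree_L i (j + 1) \<Longrightarrow> agree_M (i + 1) j \<Longrightarrow> agree_M i j"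
  by (rule transport_corner[where z = "y j" and X = "M (i + 1) j" and X' = "M' (i + 1) j"
        and N = "L i (j + 1)" and N' = "L' i (j + 1)"
        and M = "L i j (y j)" and M' = "L' i j (y j)"])
     (simp_all add: cmc nonzero det_at_roots cell)

lemma det_cell:
  assumes "z \<noteq> 0"
  shows "det (M (i + 1) j z) * det (L i j z) = det (L i (j + 1) z) * det (M i j z)"
  using arg_cong[OF cell(1)[OF assms], of det] by (simp add: det_mul)

text \<open>Regularity of \<open>M (i + 1) j\<close> at \<open>x i\<close> has to be derived first.
  Since \<open>L i j\<close> has no root in common with \<open>M i j\<close>, the determinant
  identity of the cell passes the roots of \<open>M i j\<close> on to \<open>M (i + 1) j\<close>,
  and these already exhaust the roots that a cmc matrix can have.\<close>

lemma agree_bottom: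
  assumes "agree_L i (j + 1)" "agree_M i j"
  shows "agree_L i j"
proof -
  have *: "det (M (i + 1) j z) = 0" if "z \<noteq> 0" "det (M' i j z) = 0" for z
  proof -
    have "det (M i j z) = 0" using sign_eq_det[OF assms(2)] that by simp
    then show ?thesis using no_common_root[OF that(1), of i j] det_cell[OF that(1), of i j] by simp
  qed
  have nz: "det (M (i + 1) j (x i)) \<noteq> 0"
    by (rule cmc_fun_det_roots[of _ "y j" "y' j"])
       (simp_all add: cmc nonzero * det_at_roots separated separated[symmetric])
  show ?thesis
    by (rule transport_bottom[where z = "x i" and X = "L i (j + 1)" and X' = "L' i (j + 1)"
          and M = "M i j" and M' = "M' i j"
          and N = "M (i + 1) j (x i)" and N' = "M' (i + 1) j (x i)"])
       (simp_all add: cmc nonzero det_at_roots cell assms nz)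
qed

lemma agree_left:
  assumes "agree_M (i + 1) j" "agree_L i j"
  shows "agree_M i j"
proof -
  have *: "det (L i (j + 1) z) = 0" if "z \<noteq> 0" "det (L' i j z) = 0" for z
  proof -
    have "det (L i j z) = 0" using sign_eq_det[OF assms(2)] that by simp
    then show ?thesis using no_common_root[OF that(1), of i j] det_cell[OF that(1), of i j] by simp
  qed
  have nz: "det (L i (j + 1) (y j)) \<noteq> 0"
    by (rule cmc_fun_det_roots[of _ "x i" "x' i"])
       (simp_all add: cmc nonzero * det_at_roots separated)
  show ?thesis
    by (rule transport_bottom[where z = "y j" and X = "M (i + 1) j" and X' = "M' (i + 1) j"
          and M = "L i j" and M' = "L' i j"
          and N = "L i (j + 1) (y j)" and N' = "L' i (j + 1) (y j)"])
       (simp_all add: cmc nonzero det_at_roots cell assms nz)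
qed

lemma agree_row_above:
  assumes "\<And>i. agree_L i j" "agree_M 0 j"
  shows "agree_M i j" "agree_L i (j + 1)"
proof -
  have "agree_M i j" for i
  proof (induction i rule: int_induct[of _ 0])
    case (step2 i)
    then have "agree_M (i - 1 + 1) j" by simp
    then show ?case using agree_left assms(1) by blast
  qed (use assms agree_right in auto)
  then show "agree_M i j" "agree_L i (j + 1)" using agree_top assms(1) by auto
qed

text \<open>To the right, the bottom edge of a cell is filled in before \<open>agree_right\<close>
  can be applied. To the left, the top and right edges of a cell give its left edge by
  \<open>agree_corner\<close>.\<close>

lemma agree_row_below:
  assumes "\<And>i. agree_L i (j + 1)" "agree_M 0 j"
  shows "agree_M i j" "agree_L i j"
proof -
  have "agree_M i j" for i
  proof (induction i rule: int_induct[of _ 0])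
    case (step1 i)
    then show ?case using agree_right[of i j] agree_bottom[of i j] assms(1) by blast
  next
    case (step2 i)
    then have "agree_M (i - 1 + 1) j" by simp
    then show ?case using agree_corner assms(1) by blast
  qed (use assms in auto)
  then show "agree_M i j" "agree_L i j" using agree_bottom assms(1) by auto
qed

lemma agree_everywhere:
  assumes "\<And>i. agree_L i 0" "\<And>j. agree_M 0 j"
  shows "agree_L i j" "agree_M i j"
proof -
  have "\<forall>i. agree_L i j" for j
  proof (induction j rule: int_induct[of _ 0])
    case (step1 j)
    then show ?case using agree_row_above(2) assms(2) by blast
  next
    case (step2 j)
    then have "agree_L i (j - 1 + 1)" for i by simp
    then show ?case using agree_row_below(2) assms(2) by blast
  qed (use assms in auto)
  then show "agree_L i j" "agree_M i j" using agree_row_above(1) assms(2) by auto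
qed

end

section \<open>Signs absorbed into the scalars of a gauge\<close>

lemma mat_mult_mat: "mat c ** mat d = (mat (c * d) :: complex^2^2)"
  by (simp add: mat_eq_mat2 mat2_mult)

lemma mat_pull:
  fixes X Y :: "complex^2^2"
  shows "Y ** (mat d ** X) = mat d ** (Y ** X)"
  by (simp add: matrix_mul_assoc mat_scalar_mult_commute[of d Y])

lemma mat_mult_mat_mult:
  fixes X Y :: "complex^2^2"
  shows "mat c ** Y ** (mat d ** X) = mat (c * d) ** (Y ** X)"
  unfolding mat_pull by (simp add: matrix_mul_assoc mat_mult_mat mult.commute)

lemma mat_mult_conj:
  fixes X Y Z :: "complex^2^2"
  shows "mat c ** (Y ** (mat d ** X) ** Z) = mat (c * d) ** (Y ** X ** Z)"
  unfolding mat_pull by (simp add: matrix_mul_assoc mat_mult_mat)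

text \<open>A constant sign on each edge can be moved into the scalars \<open>c\<close> and
  \<open>c'\<close>. What needs proof is that these signs do not affect the compatibility condition;
  regularity at \<open>1\<close> serves this purpose.\<close>

lemma gauge_related_sign_eq:
  assumes rel: "gauge_related \<rho> \<sigma> (L', M') Q"
    and comp: "compatible L M" "compatible L' M'"
    and sign: "\<And>i j. sign_eq (L i j) (L' i j)" "\<And>i j. sign_eq (M i j) (M' i j)"
    and reg: "\<And>i j. det (L' i j 1) \<noteq> 0" "\<And>i j. det (M' i j 1) \<noteq> 0"
  shows "gauge_related \<rho> \<sigma> (L, M) Q"
proof -
  have "\<forall>i j. \<exists>e. (e = 1 \<or> e = -1) \<and> (\<forall>z. L' i j z = mat e ** L i j z)"
    using sign(1)[THEN sign_eq_sym] unfolding sign_eq_def by blast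
  then obtain e where e: "\<And>i j. e i j = 1 \<or> e i j = -1" "\<And>i j z. L' i j z = mat (e i j) ** L i j z"
    by metis
  have "\<forall>i j. \<exists>e. (e = 1 \<or> e = -1) \<and> (\<forall>z. M' i j z = mat e ** M i j z)"
    using sign(2)[THEN sign_eq_sym] unfolding sign_eq_def by blast
  then obtain e' where e': "\<And>i j. e' i j = 1 \<or> e' i j = -1" "\<And>i j z. M' i j z = mat (e' i j) ** M i j z"
    by metis
  \<comment> \<open>The compatibility equations of the two pairs at \<open>z = 1\<close> compare
    both sign products as multiples of the same matrix \<open>X\<close>, which is
    invertible.\<close>
  have ee: "e' (i + 1) j * e i j = e i (j + 1) * e' i j" for i j
  proof -
    define X where "X = M (i + 1) j 1 ** L i j 1"
    have X': "X = L i (j + 1) 1 ** M i j 1" using comp(1) unfolding compatible_def X_def by simp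
    have "mat (e' (i + 1) j * e i j) ** X = M' (i + 1) j 1 ** L' i j 1"
      unfolding e e' X_def by (rule mat_mult_mat_mult[symmetric])
    also have "\<dots> = L' i (j + 1) 1 ** M' i j 1" using comp(2) unfolding compatible_def by simp
    also have "\<dots> = mat (e i (j + 1) * e' i j) ** X"
      unfolding e e' X' by (rule mat_mult_mat_mult)
    finally have *: "mat (e' (i + 1) j * e i j) ** X = mat (e i (j + 1) * e' i j) ** X" .
    have "det (L i j 1) \<noteq> 0" "det (M (i + 1) j 1) \<noteq> 0"
      using sign_eq_det[OF sign(1), of _ _ 1] sign_eq_det[OF sign(2), of _ _ 1] reg by simp_all
    then have "det X \<noteq> 0" unfolding X_def det_mul by simp
    then obtain Y where "X ** Y = mat 1" using invertible_det_nz unfolding invertible_def by blast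
    then have "mat (e' (i + 1) j * e i j) = (mat (e i (j + 1) * e' i j) :: complex^2^2)"
      using arg_cong[OF *, of "\<lambda>W. W ** Y"] by (simp flip: matrix_mul_assoc)
    then show ?thesis by (simp add: mat_eq_mat2 mat2_eq_iff)
  qed
  obtain N N' where Q: "Q = (N, N')" by (cases Q)
  obtain G c c' where inv: "\<And>i j. invertible (G i j) \<and> c i j \<noteq> 0 \<and> c' i j \<noteq> 0"
    and cc: "\<And>i j. c' (i + 1) j * c i j = c i (j + 1) * c' i j"
    and N: "\<And>i j z. cmod z = 1 \<Longrightarrow> N i j (\<sigma> z) = mat (c i j) ** (G (i + 1) j ** L' i j (\<rho> z) ** matrix_inv (G i j))"
    and N': "\<And>i j z. cmod z = 1 \<Longrightarrow> N' i j (\<sigma> z) = mat (c' i j) ** (G i (j + 1) ** M' i j (\<rho> z) ** matrix_inv (G i j))"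
    using rel unfolding gauge_related_def Q split by blast
  show ?thesis
    unfolding gauge_related_def Q split
  proof (rule exI[of _ G], rule exI[of _ "\<lambda>i j. c i j * e i j"], rule exI[of _ "\<lambda>i j. c' i j * e' i j"],
      intro conjI allI impI)
    fix i j
    show "invertible (G i j)" "c i j * e i j \<noteq> 0" "c' i j * e' i j \<noteq> 0"
      using inv e(1)[of i j] e'(1)[of i j] by auto
    show "c' (i + 1) j * e' (i + 1) j * (c i j * e i j) = c i (j + 1) * e i (j + 1) * (c' i j * e' i j)"
      using cc[of i j] ee[of i j] by (metis mult.assoc mult.left_commute)
  qed (simp_all add: N N' e e' mat_mult_conj)
qed

section \<open>Cross-ratio systems\<close>

definition pos_real :: "complex \<Rightarrow> bool" where
  "pos_real z \<longleftrightarrow> (\<exists>r>0. z = complex_of_real r)"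

lemma pos_real_scale:
  assumes "c > 0"
  shows "pos_real (complex_of_real c * z) \<longleftrightarrow> pos_real z"
proof
  assume "pos_real (complex_of_real c * z)"
  then obtain r where "r > 0" "complex_of_real c * z = complex_of_real r" unfolding pos_real_def by blast
  then have "z = complex_of_real (r / c)" "r / c > 0" using assms by (auto simp: field_simps)
  then show "pos_real z" unfolding pos_real_def by blast
next
  assume "pos_real z"
  then show "pos_real (complex_of_real c * z)"
    using assms unfolding pos_real_def by (metis mult_pos_pos of_real_mult)
qed

lemma pos_real_chain:
  fixes g :: "int \<Rightarrow> complex"
  assumes "pos_real (g 0)" "\<And>n. \<exists>c>0. g (n + 1) = complex_of_real c * g n"
  shows "pos_real (g n)"
proof (induction n rule: int_induct[of _ 0])
  case (step1 i)
  then show ?case using assms(2)[of i] pos_real_scale by metis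
next
  case (step2 i)
  then show ?case using assms(2)[of "i - 1"] pos_real_scale by (metis diff_add_cancel)
qed (rule assms(1))

lemma diag_nth [simp]: "diag i j $ 1 = i" "diag i j $ 2 = j" "diag i j $ 3 = i" "diag i j $ 4 = j"
  by (simp_all add: diag_def vector_def)

lemma ee_nth: "ee i $ k = (if k = i then 1 else 0)"
  by (simp add: ee_def axis_def)

lemma diag_add_ee:
  "diag i j + ee 1 + ee 3 = diag (i + 1) j" "diag i j + ee 2 + ee 4 = diag i (j + 1)"
  by (simp_all add: vec_eq_iff forall_4 ee_nth)

lemma diag_0: "diag 0 0 = 0"
  by (simp add: vec_eq_iff forall_4)

lemma index4_mod: "(5::4) = 1" "(6::4) = 2" "(7::4) = 3"
  by simp_all

section \<open>Filling the plane from three corners of each unit square\<close>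

definition closed2 :: "(int \<Rightarrow> int \<Rightarrow> bool) \<Rightarrow> bool" where
  "closed2 P \<longleftrightarrow> (\<forall>a c.
     (P a c \<and> P (a + 1) c \<and> P a (c + 1) \<longrightarrow> P (a + 1) (c + 1)) \<and>
     (P (a + 1) (c + 1) \<and> P (a + 1) c \<and> P a (c + 1) \<longrightarrow> P a c) \<and>
     (P (a + 1) (c + 1) \<and> P a c \<and> P a (c + 1) \<longrightarrow> P (a + 1) c) \<and>
     (P (a + 1) (c + 1) \<and> P a c \<and> P (a + 1) c \<longrightarrow> P a (c + 1)))"

lemma closed2_axes:
  assumes "closed2 P" "\<And>a. P a 0" "\<And>c. P 0 c"
  shows "P a c"
proof -
  have "\<forall>a. P a c"
  proof (induction c rule: int_induct[of _ 0])
    case (step1 c)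
    show ?case
    proof
      fix a show "P a (c + 1)"
      proof (induction a rule: int_induct[of _ 0])
        case (step1 a)
        then show ?case using assms(1) \<open>\<forall>a. P a c\<close> unfolding closed2_def by blast
      next
        case (step2 a)
        have "P (a - 1) c" "P (a - 1 + 1) c" "P (a - 1 + 1) (c + 1)" using step2 \<open>\<forall>a. P a c\<close> by auto
        then show ?case using assms(1) unfolding closed2_def by blast
      qed (rule assms)
    qed
  next
    case (step2 c)
    show ?case
    proof
      fix a show "P a (c - 1)"
      proof (induction a rule: int_induct[of _ 0])
        case (step1 a)
        have "P a (c - 1)" "P a (c - 1 + 1)" "P (a + 1) (c - 1 + 1)" using step1 \<open>\<forall>a. P a c\<close> by auto
        then show ?case using assms(1) unfolding closed2_def by blast
      next
        case (step2 a)
        have "P (a - 1 + 1) (c - 1)" "P (a - 1) (c - 1 + 1)" "P (a - 1 + 1) (c - 1 + 1)"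
          using step2 \<open>\<forall>a. P a c\<close> by auto
        then show ?case using assms(1) unfolding closed2_def by blast
      qed (rule assms)
    qed
  qed (use assms in auto)
  then show ?thesis by blast
qed

text \<open>Two adjacent diagonals form a staircase. Each unit square with three corners on it
  contributes a point of the next parallel diagonal, on either side; therefore the induction on the
  offset carries two adjacent diagonals.\<close>

lemma closed2_diagonal:
  assumes "closed2 P" "\<And>n. P n n" "\<And>n. P (n + 1) n" "\<And>n. P n (n + 1)"
  shows "P a c"
proof -
  have offset: "(\<forall>n. P n (n + k)) \<and> (\<forall>n. P n (n + k + 1))" for k
  proof (induction k rule: int_induct[of _ 0])
    case base
    then show ?case using assms by simp
  next
    case (step1 k)
    have "P n (n + k + 1 + 1)" for n
    proof -
      have "P n (n + k + 1)" "P (n + 1) (n + 1 + k + 1)" "P (n + 1) (n + 1 + k)" using step1 by blast+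
      then have "P n (n + k + 1)" "P (n + 1) (n + k + 1 + 1)" "P (n + 1) (n + k + 1)"
        by (simp_all add: algebra_simps)
      then show ?thesis using assms(1) unfolding closed2_def by blast
    qed
    then show ?case using step1 by (simp add: add.assoc)
  next
    case (step2 k)
    have "P n (n + k - 1)" for n
    proof -
      have "P (n - 1) (n - 1 + k)" "P (n - 1) (n - 1 + k + 1)" "P n (n + k)" using step2 by blast+
      then have "P (n - 1) (n + k - 1)" "P (n - 1) (n + k - 1 + 1)" "P (n - 1 + 1) (n + k - 1 + 1)"
        by (simp_all add: algebra_simps)
      then have "P (n - 1 + 1) (n + k - 1)" using assms(1) unfolding closed2_def by blast
      then show ?thesis by simp
    qed
    then show ?case using step2 by (simp add: algebra_simps)
  qed
  have "P a (a + (c - a))" using offset by blast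
  then show ?thesis by simp
qed

section \<open>The quad equation of the map \<open>s\<close>\<close>

locale cross_ratio_s =
  fixes f :: "int^4 \<Rightarrow> complex" and \<alpha> :: "4 \<Rightarrow> int^4 \<Rightarrow> complex" and s :: "int^4 \<Rightarrow> complex"
  assumes crs: "cross_ratio_system f \<alpha>" and smap: "is_s_map f \<alpha> s"
begin

lemma f_distinct:
  assumes "i \<noteq> j"
  shows "distinct [f x, f (x + ee i), f (x + ee j), f (x + ee i + ee j)]"
  using crs assms unfolding cross_ratio_system_def by blast

lemma label_nonzero: "\<alpha> i x \<noteq> 0"
  using crs unfolding cross_ratio_system_def by (elim conjE) (drule spec, erule spec)

lemma label_shift: "i \<noteq> j \<Longrightarrow> \<alpha> i (x + ee j) = \<alpha> i x"
  using crs unfolding cross_ratio_system_def by (elim conjE) simp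

text \<open>Translations in the other directions preserve the label, and \<open>y\<close> is reached
  from \<open>x\<close> by three of them. Modulo 4 the other directions are \<open>i + 1\<close>,
  \<open>i + 2\<close> and \<open>i + 3\<close>.\<close>

lemma label_cong:
  assumes "x $ i = y $ i"
  shows "\<alpha> i x = \<alpha> i y"
proof -
  have shift: "\<alpha> i (z + axis j k) = \<alpha> i z" if "i \<noteq> j" for z :: "int^4" and j k
  proof (induction k rule: int_induct[of _ 0])
    case base
    have "z + axis j 0 = z" by (simp add: vec_eq_iff axis_def)
    then show ?case by (simp only:)
  next
    case (step1 k)
    have "z + axis j (k + 1) = z + axis j k + ee j" by (simp add: vec_eq_iff axis_def ee_def)
    then show ?case using step1 by (simp only: label_shift[OF that])
  next
    case (step2 k)
    have "z + axis j k = z + axis j (k - 1) + ee j" by (simp add: vec_eq_iff axis_def ee_def)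
    then show ?case using step2 by (simp only: label_shift[OF that])
  qed
  have ne: "i \<noteq> i + 1" "i \<noteq> i + 2" "i \<noteq> i + 3" by simp_all
  have index: "k = i \<or> k = i + 1 \<or> k = i + 2 \<or> k = i + 3" for k
    using exhaust_4[of i] exhaust_4[of k] by (elim disjE; hypsubst; simp)
  have "y $ k = (x + axis (i + 1) (y $ (i + 1) - x $ (i + 1)) + axis (i + 2) (y $ (i + 2) - x $ (i + 2))
      + axis (i + 3) (y $ (i + 3) - x $ (i + 3))) $ k" for k
    using index[of k] assms by (elim disjE) (simp_all add: axis_def)
  then have "y = x + axis (i + 1) (y $ (i + 1) - x $ (i + 1)) + axis (i + 2) (y $ (i + 2) - x $ (i + 2))
      + axis (i + 3) (y $ (i + 3) - x $ (i + 3))"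
    unfolding vec_eq_iff by blast
  then show ?thesis using shift[OF ne(1)] shift[OF ne(2)] shift[OF ne(3)] by metis
qed

lemma s_0: "s 0 = 1"
  using smap unfolding is_s_map_def by blast

lemma f_step: "f (x + ee i) = f x + \<alpha> i x * s (x + ee i) * s x"
proof -
  have "f (x + ee i) - f x = \<alpha> i x * s (x + ee i) * s x"
    using smap unfolding is_s_map_def edge_def by blast
  then show ?thesis by (simp add: diff_eq_eq add.commute)
qed

lemma s_nonzero: "s x \<noteq> 0"
proof
  assume "s x = 0"
  then have "f (x + ee 1) = f x" by (simp add: f_step)
  then show False using f_distinct[of 1 2 x] by simp
qed

lemma ee_commute: "x + ee j + ee i = x + ee i + ee j"
  by (simp add: ac_simps)

lemma f_opposite:
  assumes "i \<noteq> j"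
  shows "f (x + ee i + ee j) = f x + s (x + ee i) * (\<alpha> i x * s x + \<alpha> j x * s (x + ee i + ee j))"
  using f_step[of x i] f_step[of "x + ee i" j] label_shift[of j i x] assms by (simp add: algebra_simps)

text \<open>Both sides are the difference of \<open>f\<close> between \<open>x\<close> and the
  opposite vertex, computed along the two paths around the quad.\<close>

lemma quad:
  assumes "i \<noteq> j"
  shows "s (x + ee i) * (\<alpha> i x * s x + \<alpha> j x * s (x + ee i + ee j)) =
    s (x + ee j) * (\<alpha> j x * s x + \<alpha> i x * s (x + ee i + ee j))"
  using f_opposite[of i j x] f_opposite[of j i x] assms by (simp add: ee_commute[of x j i])

lemma opposite_nonzero:
  assumes "i \<noteq> j"
  shows "\<alpha> i x * s x + \<alpha> j x * s (x + ee i + ee j) \<noteq> 0"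
  using f_opposite[OF assms, of x] f_distinct[OF assms, of x] by auto

text \<open>Both claims express \<open>f (x + ee i) \<noteq> f (x + ee j)\<close>, once with the
  edges at \<open>x\<close> and once with those at the opposite vertex. Together with
  \<open>opposite_nonzero\<close> they bound away from zero the coefficients needed to solve the
  quad equation for any one of its vertices.\<close>

lemma other_diagonal_nonzero:
  assumes "i \<noteq> j"
  shows "\<alpha> i x * s (x + ee i) - \<alpha> j x * s (x + ee j) \<noteq> 0"
    and "\<alpha> j x * s (x + ee i) - \<alpha> i x * s (x + ee j) \<noteq> 0"
proof -
  have "f (x + ee i) \<noteq> f (x + ee j)" using f_distinct[OF assms, of x] by auto
  moreover have "f (x + ee i) - f (x + ee j) = s x * (\<alpha> i x * s (x + ee i) - \<alpha> j x * s (x + ee j))"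
    by (simp add: f_step algebra_simps)
  moreover have "f (x + ee j) - f (x + ee i) =
      s (x + ee i + ee j) * (\<alpha> j x * s (x + ee i) - \<alpha> i x * s (x + ee j))"
    using f_step[of "x + ee i" j] f_step[of "x + ee j" i] label_shift[of j i x] label_shift[of i j x] assms
    by (simp add: algebra_simps ee_commute[of x j i])
  ultimately show "\<alpha> i x * s (x + ee i) - \<alpha> j x * s (x + ee j) \<noteq> 0"
    "\<alpha> j x * s (x + ee i) - \<alpha> i x * s (x + ee j) \<noteq> 0" by auto
qed

text \<open>If the labels agreed up to sign, a factor nonzero by \<open>opposite_nonzero\<close>
  would cancel from the quad equation. What is left would make the points
  \<open>f (x + ee i)\<close> and \<open>f (x + ee j)\<close> coincide.\<close>

lemma labels_square_distinct:
  assumes "i \<noteq> j"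
  shows "(\<alpha> i x)\<^sup>2 \<noteq> (\<alpha> j x)\<^sup>2"
proof
  assume "(\<alpha> i x)\<^sup>2 = (\<alpha> j x)\<^sup>2"
  then consider "\<alpha> i x = \<alpha> j x" | "\<alpha> i x = - \<alpha> j x" unfolding power2_eq_iff by blast
  then show False
  proof cases
    case 1
    then show False
      using quad[OF assms, of x] opposite_nonzero[OF assms, of x] other_diagonal_nonzero(1)[OF assms, of x] by simp
  next
    case 2
    then have "(s (x + ee i) + s (x + ee j)) * (\<alpha> i x * s x + \<alpha> j x * s (x + ee i + ee j)) = 0"
      using quad[OF assms, of x] by (simp add: algebra_simps)
    then have "s (x + ee i) + s (x + ee j) = 0" using opposite_nonzero[OF assms, of x] by simp
    then have "s (x + ee i) = - s (x + ee j)" by (simp add: add_eq_0_iff2)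
    then show False using 2 other_diagonal_nonzero(1)[OF assms, of x] by simp
  qed
qed

text \<open>The two conditions express the data of direction \<open>k\<close> by those of direction
  \<open>i\<close>. After clearing denominators in the quad equation, the coefficients contain only
  the squared moduli of \<open>A\<close> and \<open>B\<close>.\<close>

lemma opposite_pos_ratio:
  assumes "i \<noteq> k" and s: "s (x + ee i) * cnj (s (x + ee k)) = 1" and \<alpha>: "\<alpha> i x * cnj (\<alpha> k x) = -1"
  shows "\<exists>c>0. s (x + ee i + ee k) = complex_of_real c * s x"
proof -
  define A B where "A = \<alpha> i x" and "B = s (x + ee i)"
  have A: "A \<noteq> 0" and B: "B \<noteq> 0" unfolding A_def B_def by (rule label_nonzero, rule s_nonzero)
  have "cnj A * \<alpha> k x = -1" "cnj B * s (x + ee k) = 1"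
    using arg_cong[OF \<alpha>, of cnj] arg_cong[OF s, of cnj] unfolding A_def B_def by auto
  then have k: "\<alpha> k x = - 1 / cnj A" "s (x + ee k) = 1 / cnj B"
    using A B by (auto simp: field_simps)
  define S S' where "S = s x" and "S' = s (x + ee i + ee k)"
  have "B * (A * S + - 1 / cnj A * S') = 1 / cnj B * (- 1 / cnj A * S + A * S')"
    using quad[OF assms(1), of x] unfolding k S_def S'_def A_def[symmetric] B_def[symmetric] .
  then have "cnj A * cnj B * (B * (A * S + - 1 / cnj A * S')) =
      cnj A * cnj B * (1 / cnj B * (- 1 / cnj A * S + A * S'))" by simp
  moreover have "cnj A * cnj B * (B * (A * S + - 1 / cnj A * S')) = (B * cnj B) * (A * cnj A * S - S')"
    "cnj A * cnj B * (1 / cnj B * (- 1 / cnj A * S + A * S')) = A * cnj A * S' - S"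
    using A B by (simp_all add: field_simps)
  ultimately have "(B * cnj B) * (A * cnj A * S - S') = A * cnj A * S' - S" by simp
  then have *: "S' * (A * cnj A + B * cnj B) = S * (1 + A * cnj A * (B * cnj B))"
    by (simp add: algebra_simps)
  define p q where "p = (cmod A)\<^sup>2 + (cmod B)\<^sup>2" and "q = 1 + (cmod A)\<^sup>2 * (cmod B)\<^sup>2"
  have pq: "p > 0" "q > 0" unfolding p_def q_def using A by (auto simp: add_pos_nonneg)
  have "S' * complex_of_real p = S * complex_of_real q"
    using * unfolding p_def q_def by (simp add: complex_norm_square flip: of_real_power)
  then have "S' = complex_of_real (q / p) * S" using pq by (simp add: field_simps)
  then show ?thesis using pq unfolding S_def S'_def by (intro exI[of _ "q / p"]) simp
qed

end

section \<open>The lattice conditions propagate from the axes\<close>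

text \<open>As \<open>k + 2\<close> is taken modulo 4, this exchanges direction 1 with 3 and
  direction 2 with 4, and it fixes the diagonal net pointwise.\<close>

definition swap :: "int^4 \<Rightarrow> int^4" where
  "swap x = (\<chi> k. x $ (k + 2))"

lemma index4_add_2: "(1::4) + 2 = 3" "(2::4) + 2 = 4" "(3::4) + 2 = 1" "(4::4) + 2 = 2"
  by simp_all

lemma swap_nth: "swap x $ 1 = x $ 3" "swap x $ 2 = x $ 4" "swap x $ 3 = x $ 1" "swap x $ 4 = x $ 2"
  unfolding swap_def vec_lambda_beta index4_add_2 by (rule refl)+

lemma swap_diag [simp]: "swap (diag i j) = diag i j"
  by (simp add: vec_eq_iff forall_4 swap_nth)

lemma swap_add_ee: "swap (x + ee i) = swap x + ee (i + 2)"
proof -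
  have "k + 2 = i \<longleftrightarrow> k = i + 2" for k :: 4
    using exhaust_4[of i] exhaust_4[of k] by (elim disjE; hypsubst; simp)
  then show ?thesis unfolding vec_eq_iff swap_def by (simp only: ee_nth vec_lambda_beta vector_add_component) simp
qed

definition parity_even :: "int^4 \<Rightarrow> bool" where
  "parity_even x \<longleftrightarrow> even (x $ 1 + x $ 2 + x $ 3 + x $ 4)"

lemma parity_add_ee: "parity_even (x + ee i) \<longleftrightarrow> \<not> parity_even x"
  using exhaust_4[of i] by (elim disjE; hypsubst; auto simp: parity_even_def ee_nth)

lemma parity_diag: "parity_even (diag i j)"
  by (simp add: parity_even_def)

context cross_ratio_s
begin

text \<open>The image of \<open>s\<close> under the involution behind the \<open>C\<^sup>+\<close>
  conditions: those on \<open>s\<close> say that \<open>dual\<close> and \<open>s\<close> agree at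
  the neighbours of the diagonal net, which are odd.\<close>

definition dual :: "int^4 \<Rightarrow> complex" where
  "dual x = (if parity_even x then cnj (s (swap x)) else 1 / cnj (s (swap x)))"

lemma cnj_s_nonzero: "cnj (s x) \<noteq> 0"
  using s_nonzero by simp

text \<open>Conjugating the quad equation at \<open>swap x\<close> brings in reciprocal labels;
  clearing denominators then interchanges the roles of \<open>i\<close> and \<open>j\<close>.
  Inverting the values at the odd vertices interchanges them back.\<close>

lemma dual_quad:
  assumes ij: "i \<noteq> j" and dual_label: "\<And>i x. \<alpha> (i + 2) (swap x) = - 1 / cnj (\<alpha> i x)"
  shows "dual (x + ee i) * (\<alpha> i x * dual x + \<alpha> j x * dual (x + ee i + ee j)) =
    dual (x + ee j) * (\<alpha> j x * dual x + \<alpha> i x * dual (x + ee i + ee j))"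
proof -
  define A B where "A = \<alpha> i x" and "B = \<alpha> j x"
  define t ti tj tij where "t = cnj (s (swap x))" and "ti = cnj (s (swap x + ee (i + 2)))"
    and "tj = cnj (s (swap x + ee (j + 2)))" and "tij = cnj (s (swap x + ee (i + 2) + ee (j + 2)))"
  note t_defs = t_def ti_def tj_def tij_def
  have nz: "A \<noteq> 0" "B \<noteq> 0" "t \<noteq> 0" "ti \<noteq> 0" "tj \<noteq> 0" "tij \<noteq> 0"
    unfolding A_def B_def t_defs by (simp_all add: label_nonzero s_nonzero)
  have "i + 2 \<noteq> j + 2" using ij by simp
  from arg_cong[OF quad[OF this, of "swap x"], of cnj]
  have "ti * (- 1 / A * t + - 1 / B * tij) = tj * (- 1 / B * t + - 1 / A * tij)"
    unfolding dual_label t_defs A_def B_def by simp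
  then have mult: "(A * B) * (ti * (- 1 / A * t + - 1 / B * tij)) = (A * B) * (tj * (- 1 / B * t + - 1 / A * tij))"
    by simp
  have expand: "(A * B) * (ti * (- 1 / A * t + - 1 / B * tij)) = - (ti * (B * t + A * tij))"
    "(A * B) * (tj * (- 1 / B * t + - 1 / A * tij)) = - (tj * (A * t + B * tij))"
    using nz by (simp_all add: field_simps)
  have eq: "ti * (B * t + A * tij) = tj * (A * t + B * tij)"
    using mult unfolding expand neg_equal_iff_equal .
  show ?thesis
  proof (cases "parity_even x")
    case True
    then have "dual x = t" "dual (x + ee i) = 1 / ti" "dual (x + ee j) = 1 / tj" "dual (x + ee i + ee j) = tij"
      by (simp_all add: dual_def parity_add_ee swap_add_ee t_defs)
    moreover have "(A * t + B * tij) / ti = (B * t + A * tij) / tj"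
      using eq nz by (simp add: frac_eq_eq mult.commute)
    ultimately show ?thesis unfolding A_def[symmetric] B_def[symmetric] by simp
  next
    case False
    then have "dual x = 1 / t" "dual (x + ee i) = ti" "dual (x + ee j) = tj" "dual (x + ee i + ee j) = 1 / tij"
      by (simp_all add: dual_def parity_add_ee swap_add_ee t_defs)
    moreover have "A / t + B / tij = (B * t + A * tij) / (t * tij)" "B / t + A / tij = (A * t + B * tij) / (t * tij)"
      using nz by (simp_all add: field_simps)
    ultimately show ?thesis using eq unfolding A_def[symmetric] B_def[symmetric] by simp
  qed
qed

text \<open>When three vertices agree, subtracting the two quad equations leaves the difference at
  the fourth vertex times a factor that is nonzero by distinctness of the points on a diagonal of
  the quad.\<close>

lemma quad_determined:
  assumes ij: "i \<noteq> j"
    and quad': "s' (x + ee i) * (\<alpha> i x * s' x + \<alpha> j x * s' (x + ee i + ee j)) =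
      s' (x + ee j) * (\<alpha> j x * s' x + \<alpha> i x * s' (x + ee i + ee j))"
  defines "E \<equiv> \<lambda>x. s' x = s x"
  shows "E x \<Longrightarrow> E (x + ee i) \<Longrightarrow> E (x + ee j) \<Longrightarrow> E (x + ee i + ee j)"
    and "E (x + ee i + ee j) \<Longrightarrow> E (x + ee i) \<Longrightarrow> E (x + ee j) \<Longrightarrow> E x"
    and "E (x + ee i + ee j) \<Longrightarrow> E x \<Longrightarrow> E (x + ee j) \<Longrightarrow> E (x + ee i)"
    and "E (x + ee i + ee j) \<Longrightarrow> E x \<Longrightarrow> E (x + ee i) \<Longrightarrow> E (x + ee j)"
proof -
  note q = quad[OF ij, of x]
  have *: "p = q \<Longrightarrow> p' = q' \<Longrightarrow> d = (p' - q') - (p - q) \<Longrightarrow> d = 0" for p q p' q' d :: complex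
    by simp
  show "E (x + ee i + ee j)" if "E x" "E (x + ee i)" "E (x + ee j)"
  proof -
    have "(\<alpha> j x * s (x + ee i) - \<alpha> i x * s (x + ee j)) * (s' (x + ee i + ee j) - s (x + ee i + ee j)) = 0"
      by (rule *[OF q quad']) (use that in \<open>simp add: E_def algebra_simps\<close>)
    then show ?thesis using other_diagonal_nonzero(2)[OF ij, of x] unfolding E_def by simp
  qed
  show "E x" if "E (x + ee i + ee j)" "E (x + ee i)" "E (x + ee j)"
  proof -
    have "(\<alpha> i x * s (x + ee i) - \<alpha> j x * s (x + ee j)) * (s' x - s x) = 0"
      by (rule *[OF q quad']) (use that in \<open>simp add: E_def algebra_simps\<close>)
    then show ?thesis using other_diagonal_nonzero(1)[OF ij, of x] unfolding E_def by simp
  qed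
  show "E (x + ee i)" if "E (x + ee i + ee j)" "E x" "E (x + ee j)"
  proof -
    have "(\<alpha> i x * s x + \<alpha> j x * s (x + ee i + ee j)) * (s' (x + ee i) - s (x + ee i)) = 0"
      by (rule *[OF q quad']) (use that in \<open>simp add: E_def algebra_simps\<close>)
    then show ?thesis using opposite_nonzero[OF ij, of x] unfolding E_def by simp
  qed
  show "E (x + ee j)" if "E (x + ee i + ee j)" "E x" "E (x + ee i)"
  proof -
    have "(\<alpha> j x * s x + \<alpha> i x * s (x + ee i + ee j)) * (s (x + ee j) - s' (x + ee j)) = 0"
      by (rule *[OF q quad']) (use that in \<open>simp add: E_def algebra_simps\<close>)
    then show ?thesis using opposite_nonzero[OF ij[symmetric], of x] unfolding E_def ee_commute[of x j i] by simp
  qed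
qed

end

section \<open>Initial data for quad equations on \<open>\<int>^4\<close>\<close>

definition pt :: "int \<Rightarrow> int \<Rightarrow> int \<Rightarrow> int \<Rightarrow> int^4" where
  "pt a b c d = vector [a, b, c, d]"

lemma pt_nth: "pt a b c d $ 1 = a" "pt a b c d $ 2 = b" "pt a b c d $ 3 = c" "pt a b c d $ 4 = d"
  by (simp_all add: pt_def vector_def)

lemma pt_eta: "pt (x $ 1) (x $ 2) (x $ 3) (x $ 4) = x"
  by (simp add: vec_eq_iff forall_4 pt_nth)

lemma pt_add_ee:
  "pt a b c d + ee 1 = pt (a + 1) b c d" "pt a b c d + ee 2 = pt a (b + 1) c d"
  "pt a b c d + ee 3 = pt a b (c + 1) d" "pt a b c d + ee 4 = pt a b c (d + 1)"
  by (simp_all add: vec_eq_iff forall_4 pt_nth ee_nth)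

lemma diag_eq_pt: "diag i j = pt i j i j"
  by (simp add: diag_def pt_def)

text \<open>Along an axis of the diagonal net the data form a staircase, which fills the coordinate
  plane 1-3 or 2-4. From coordinate axes the plane 1-2 is filled next, from coordinate planes the
  spaces 1-2-3 and 1-2-4, and from these all of \<open>\<int>^4\<close>.\<close>

lemma quad_closed_everywhere:
  fixes E :: "int^4 \<Rightarrow> bool"
  assumes closed: "\<And>i j x. i \<noteq> j \<Longrightarrow>
       (E x \<and> E (x + ee i) \<and> E (x + ee j) \<longrightarrow> E (x + ee i + ee j)) \<and>
       (E (x + ee i + ee j) \<and> E (x + ee i) \<and> E (x + ee j) \<longrightarrow> E x) \<and>
       (E (x + ee i + ee j) \<and> E x \<and> E (x + ee j) \<longrightarrow> E (x + ee i)) \<and>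
       (E (x + ee i + ee j) \<and> E x \<and> E (x + ee i) \<longrightarrow> E (x + ee j))"
    and axis1: "\<And>n. E (diag n 0)" "\<And>n. E (diag n 0 + ee 1)" "\<And>n. E (diag n 0 + ee 3)"
    and axis2: "\<And>n. E (diag 0 n)" "\<And>n. E (diag 0 n + ee 2)" "\<And>n. E (diag 0 n + ee 4)"
  shows "E x"
proof -
  define F where "F a b c d = E (pt a b c d)" for a b c d
  have closed_13: "closed2 (\<lambda>a c. F a b c d)" for b d
    unfolding closed2_def F_def
  proof (intro allI, goal_cases)
    case (1 a c)
    have ne: "1 \<noteq> (3 :: 4)" by simp
    show ?case using closed[OF ne, of "pt a b c d"] unfolding pt_add_ee .
  qed
  have closed_24: "closed2 (\<lambda>b d. F a b c d)" for a c
    unfolding closed2_def F_def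
  proof (intro allI, goal_cases)
    case (1 b d)
    have ne: "2 \<noteq> (4 :: 4)" by simp
    show ?case using closed[OF ne, of "pt a b c d"] unfolding pt_add_ee .
  qed
  have closed_12: "closed2 (\<lambda>a b. F a b c d)" for c d
    unfolding closed2_def F_def
  proof (intro allI, goal_cases)
    case (1 a b)
    have ne: "1 \<noteq> (2 :: 4)" by simp
    show ?case using closed[OF ne, of "pt a b c d"] unfolding pt_add_ee .
  qed
  have closed_32: "closed2 (\<lambda>c b. F a b c d)" for a d
    unfolding closed2_def F_def
  proof (intro allI, goal_cases)
    case (1 c b)
    have ne: "3 \<noteq> (2 :: 4)" by simp
    show ?case using closed[OF ne, of "pt a b c d"] unfolding pt_add_ee .
  qed
  have closed_14: "closed2 (\<lambda>a d. F a b c d)" for b c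
    unfolding closed2_def F_def
  proof (intro allI, goal_cases)
    case (1 a d)
    have ne: "1 \<noteq> (4 :: 4)" by simp
    show ?case using closed[OF ne, of "pt a b c d"] unfolding pt_add_ee .
  qed
  have closed_34: "closed2 (\<lambda>c d. F a b c d)" for a b
    unfolding closed2_def F_def
  proof (intro allI, goal_cases)
    case (1 c d)
    have ne: "3 \<noteq> (4 :: 4)" by simp
    show ?case using closed[OF ne, of "pt a b c d"] unfolding pt_add_ee .
  qed
  have 13: "F a 0 c 0" for a c
    by (rule closed2_diagonal[OF closed_13])
       (use axis1 in \<open>simp_all add: F_def diag_eq_pt pt_add_ee\<close>)
  have 24: "F 0 b 0 d" for b d
    by (rule closed2_diagonal[OF closed_24])
       (use axis2 in \<open>simp_all add: F_def diag_eq_pt pt_add_ee\<close>)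
  have 12: "F a b 0 0" for a b by (rule closed2_axes[OF closed_12]) (rule 13 24)+
  have 123: "F a b c 0" for a b c by (rule closed2_axes[OF closed_32]) (rule 13 12)+
  have 124: "F a b 0 d" for a b d by (rule closed2_axes[OF closed_14]) (rule 12 24)+
  have "F a b c d" for a b c d by (rule closed2_axes[OF closed_34]) (rule 123 124)+
  then show ?thesis using pt_eta[of x] unfolding F_def by metis
qed

section \<open>The lattice conditions as invariance under the involution\<close>

definition C_plus_at :: "(4 \<Rightarrow> int^4 \<Rightarrow> complex) \<Rightarrow> (int^4 \<Rightarrow> complex) \<Rightarrow> 4 \<Rightarrow> int^4 \<Rightarrow> bool" where
  "C_plus_at \<alpha> s i x \<longleftrightarrow> s (x + ee i) * cnj (s (x + ee (i + 2))) = 1 \<and> \<alpha> i x * cnj (\<alpha> (i + 2) x) = -1"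

context cross_ratio_s
begin

lemma C_plus_at_pos_ratio:
  assumes "C_plus_at \<alpha> s i x"
  shows "\<exists>c>0. s (x + ee i + ee (i + 2)) = complex_of_real c * s x"
  by (rule opposite_pos_ratio) (use assms in \<open>auto simp: C_plus_at_def\<close>)

lemma s_pos_axes:
  assumes "\<And>n. C_plus_at \<alpha> s 1 (diag n 0)" "\<And>n. C_plus_at \<alpha> s 2 (diag 0 n)"
  shows "pos_real (s (diag n 0))" "pos_real (s (diag 0 n))"
proof -
  have 0: "pos_real (s (diag 0 0))" unfolding diag_0 s_0 pos_real_def by (intro exI[of _ 1]) simp
  show "pos_real (s (diag n 0))"
    by (rule pos_real_chain[of "\<lambda>n. s (diag n 0)"], rule 0)
       (use C_plus_at_pos_ratio[OF assms(1)] in \<open>simp add: diag_add_ee\<close>)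
  show "pos_real (s (diag 0 n))"
    by (rule pos_real_chain[of "\<lambda>n. s (diag 0 n)"], rule 0)
       (use C_plus_at_pos_ratio[OF assms(2)] in \<open>simp add: diag_add_ee\<close>)
qed

lemma s_pos_diag:
  assumes "\<And>i j. C_plus_at \<alpha> s 1 (diag i j)" "\<And>i j. C_plus_at \<alpha> s 2 (diag i j)"
  shows "pos_real (s (diag i j))"
  by (rule pos_real_chain[of "\<lambda>j. s (diag i j)"], rule s_pos_axes(1)[OF assms])
     (use C_plus_at_pos_ratio[OF assms(2)] in \<open>simp add: diag_add_ee\<close>)

text \<open>\<open>dual\<close> solves the same quad equations as \<open>s\<close>. The conditions
  on the axes and the positivity of \<open>s\<close> there make both agree on the initial data,
  hence everywhere; next to the diagonal net, equality of \<open>dual\<close> and \<open>s\<close>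
  is the desired condition.\<close>

lemma C_plus_from_axes:
  assumes axes: "\<And>n. C_plus_at \<alpha> s 1 (diag n 0)" "\<And>n. C_plus_at \<alpha> s 2 (diag 0 n)"
  shows "C_plus_at \<alpha> s 1 (diag i j)" "C_plus_at \<alpha> s 2 (diag i j)"
proof -
  \<comment> \<open>A label depends on its own coordinate only, so the condition on labels carries
    over from the axes to every pair of points related by \<open>swap\<close>.\<close>
  have dual_label: "\<alpha> (i + 2) (swap x) = - 1 / cnj (\<alpha> i x)" for i x
  proof -
    have opp: "b = - 1 / cnj a \<and> a = - 1 / cnj b" if "a * cnj b = -1" for a b
    proof -
      have "a \<noteq> 0" "b \<noteq> 0" using that by auto
      moreover have "cnj a * b = -1" using arg_cong[OF that, of cnj] by simp
      ultimately show ?thesis using that by (auto simp: field_simps)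
    qed
    have 13: "\<alpha> 1 x * cnj (\<alpha> 3 y) = -1" if "x $ 1 = y $ 3" for x y
    proof -
      have "\<alpha> 1 x = \<alpha> 1 (diag (x $ 1) 0)" "\<alpha> 3 y = \<alpha> 3 (diag (x $ 1) 0)"
        using that by (auto intro: label_cong)
      then show ?thesis using axes(1)[of "x $ 1"] unfolding C_plus_at_def by simp
    qed
    have 24: "\<alpha> 2 x * cnj (\<alpha> 4 y) = -1" if "x $ 2 = y $ 4" for x y
    proof -
      have "\<alpha> 2 x = \<alpha> 2 (diag 0 (x $ 2))" "\<alpha> 4 y = \<alpha> 4 (diag 0 (x $ 2))"
        using that by (auto intro: label_cong)
      then show ?thesis using axes(2)[of "x $ 2"] unfolding C_plus_at_def by simp
    qed
    have "\<alpha> 3 (swap x) = - 1 / cnj (\<alpha> 1 x)" "\<alpha> 1 (swap x) = - 1 / cnj (\<alpha> 3 x)"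
      by (rule opp[THEN conjunct1], rule 13, simp add: swap_nth, rule opp[THEN conjunct2], rule 13, simp add: swap_nth)
    moreover have "\<alpha> 4 (swap x) = - 1 / cnj (\<alpha> 2 x)" "\<alpha> 2 (swap x) = - 1 / cnj (\<alpha> 4 x)"
      by (rule opp[THEN conjunct1], rule 24, simp add: swap_nth, rule opp[THEN conjunct2], rule 24, simp add: swap_nth)
    ultimately show ?thesis
      using exhaust_4[of i] by (elim disjE; hypsubst; simp only: index4_add_2)
  qed
  have real: "cnj z = z" if "pos_real z" for z using that unfolding pos_real_def by auto
  have inverse: "b = 1 / cnj a \<and> a = 1 / cnj b" if "a * cnj b = 1" for a b
  proof -
    have "a \<noteq> 0" "b \<noteq> 0" using that by auto
    moreover have "cnj a * b = 1" using arg_cong[OF that, of cnj] by simp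
    ultimately show ?thesis using that by (auto simp: field_simps)
  qed
  have dual_eq: "dual x = s x" for x
  proof (rule quad_closed_everywhere[where E = "\<lambda>x. dual x = s x"])
    fix i j :: 4 and x assume "i \<noteq> j"
    from quad_determined[where s' = dual, OF this dual_quad[OF this dual_label]]
    show "(dual x = s x \<and> dual (x + ee i) = s (x + ee i) \<and> dual (x + ee j) = s (x + ee j) \<longrightarrow>
            dual (x + ee i + ee j) = s (x + ee i + ee j)) \<and>
          (dual (x + ee i + ee j) = s (x + ee i + ee j) \<and> dual (x + ee i) = s (x + ee i) \<and>
            dual (x + ee j) = s (x + ee j) \<longrightarrow> dual x = s x) \<and>
          (dual (x + ee i + ee j) = s (x + ee i + ee j) \<and> dual x = s x \<and> dual (x + ee j) = s (x + ee j) \<longrightarrow>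
            dual (x + ee i) = s (x + ee i)) \<and>
          (dual (x + ee i + ee j) = s (x + ee i + ee j) \<and> dual x = s x \<and> dual (x + ee i) = s (x + ee i) \<longrightarrow>
            dual (x + ee j) = s (x + ee j))"
      by blast
  next
    fix n
    show "dual (diag n 0) = s (diag n 0)" "dual (diag 0 n) = s (diag 0 n)"
      using s_pos_axes[OF axes, of n] by (simp_all add: dual_def parity_diag real)
    have "s (diag n 0 + ee 1) * cnj (s (diag n 0 + ee 3)) = 1"
      using axes(1)[of n] by (simp add: C_plus_at_def)
    note inv = inverse[OF this]
    have "dual (diag n 0 + ee 1) = 1 / cnj (s (diag n 0 + ee 3))"
      by (simp add: dual_def parity_diag parity_add_ee swap_add_ee)
    then show "dual (diag n 0 + ee 1) = s (diag n 0 + ee 1)" by (rule trans) (rule inv[THEN conjunct2, symmetric])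
    have "dual (diag n 0 + ee 3) = 1 / cnj (s (diag n 0 + ee 1))"
      by (simp add: dual_def parity_diag parity_add_ee swap_add_ee index4_mod)
    then show "dual (diag n 0 + ee 3) = s (diag n 0 + ee 3)" by (rule trans) (rule inv[THEN conjunct1, symmetric])
  next
    fix n
    have "s (diag 0 n + ee 2) * cnj (s (diag 0 n + ee 4)) = 1"
      using axes(2)[of n] by (simp add: C_plus_at_def)
    note inv = inverse[OF this]
    have "dual (diag 0 n + ee 2) = 1 / cnj (s (diag 0 n + ee 4))"
      by (simp add: dual_def parity_diag parity_add_ee swap_add_ee)
    then show "dual (diag 0 n + ee 2) = s (diag 0 n + ee 2)" by (rule trans) (rule inv[THEN conjunct2, symmetric])
    have "dual (diag 0 n + ee 4) = 1 / cnj (s (diag 0 n + ee 2))"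
      by (simp add: dual_def parity_diag parity_add_ee swap_add_ee index4_mod)
    then show "dual (diag 0 n + ee 4) = s (diag 0 n + ee 4)" by (rule trans) (rule inv[THEN conjunct1, symmetric])
  qed
  have s: "s (diag i j + ee k) * cnj (s (diag i j + ee (k + 2))) = 1" for k
  proof -
    have "s (diag i j + ee k) = 1 / cnj (s (diag i j + ee (k + 2)))"
      using dual_eq[of "diag i j + ee k"] by (simp add: dual_def parity_diag parity_add_ee swap_add_ee)
    then show ?thesis using cnj_s_nonzero by simp
  qed
  have \<alpha>: "\<alpha> k (diag i j) * cnj (\<alpha> (k + 2) (diag i j)) = -1" for k
    using dual_label[of k "diag i j"] label_nonzero[of k "diag i j"] by simp
  show "C_plus_at \<alpha> s 1 (diag i j)" "C_plus_at \<alpha> s 2 (diag i j)"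
    unfolding C_plus_at_def using s \<alpha> by blast+
qed

end

lemma C_plus_lattice_iff:
  "C_plus_lattice f \<alpha> \<longleftrightarrow> (\<exists>s. cross_ratio_s f \<alpha> s \<and>
     (\<forall>i j. C_plus_at \<alpha> s 1 (diag i j) \<and> C_plus_at \<alpha> s 2 (diag i j)))"
  unfolding C_plus_lattice_def C_plus_at_def cross_ratio_s_def by (auto simp: split_beta)

section \<open>Gauging the diagonal matrices\<close>

text \<open>\<open>r\<close> stands for the square root of \<open>s\<close> at the vertex and
  \<open>n\<close> for its parity. The odd form is the quarter rotation applied after the even form;
  both have determinant 1.\<close>

definition gauge_matrix :: "int \<Rightarrow> complex \<Rightarrow> complex^2^2" where
  "gauge_matrix n r = (if even n then mat2 (1 / r) 0 0 r else mat2 0 r (- 1 / r) 0)"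

lemma gauge_matrix_inv:
  assumes "r \<noteq> 0"
  shows "matrix_inv (gauge_matrix n r) = (if even n then mat2 r 0 0 (1 / r) else mat2 0 (- r) (1 / r) 0)"
    and "invertible (gauge_matrix n r)" "det (gauge_matrix n r) = 1" "det (matrix_inv (gauge_matrix n r)) = 1"
proof -
  show *: "matrix_inv (gauge_matrix n r) = (if even n then mat2 r 0 0 (1 / r) else mat2 0 (- r) (1 / r) 0)"
    by (rule matrix_inv_unique) (use assms in \<open>simp add: gauge_matrix_def mat2_mult mat_eq_mat2\<close>)
  show "det (gauge_matrix n r) = 1" using assms by (simp add: gauge_matrix_def det_mat2)
  then show "invertible (gauge_matrix n r)" by (simp add: invertible_det_nz)
  show "det (matrix_inv (gauge_matrix n r)) = 1" unfolding * using assms by (simp add: det_mat2)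
qed

lemma gauge_matrix_inv_kernel_vector:
  assumes "r \<noteq> 0"
  shows "\<exists>c. matrix_inv (gauge_matrix n r) *v kernel_vector n t = mat c *v vector [t * r\<^sup>2, - \<i>]"
proof (cases "even n")
  case True
  then show ?thesis using assms
    by (intro exI[of _ "1 / r"])
       (simp add: gauge_matrix_inv kernel_vector_def mat_eq_mat2 mat2_vector power2_eq_square mult.commute)
next
  case False
  then show ?thesis using assms
    by (intro exI[of _ "- 1 / r"])
       (simp add: gauge_matrix_inv kernel_vector_def mat_eq_mat2 mat2_vector power2_eq_square mult.commute)
qed

text \<open>The parity \<open>n\<close> of the initial vertex decides which end of the edge is
  rotated, and thereby which off-diagonal entry arrives in the upper left corner.\<close>

definition field_a :: "int \<Rightarrow> complex \<Rightarrow> complex" where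
  "field_a n A = (if even n then - cnj A else A)"

definition field_b :: "int \<Rightarrow> complex \<Rightarrow> complex \<Rightarrow> complex \<Rightarrow> complex" where
  "field_b n r q u = (if even n then q / (r * u) else - r / (q * u))"

text \<open>Division by the unit scalar \<open>u\<close> balances the two terms of each diagonal
  entry, so that the upper off-diagonal entry of the result is \<open>z * b + 1 / (z * b)\<close>.
  The hypothesis on \<open>cnj A\<close> makes the two constant entries conjugate to each
  other.\<close>

lemma gauged_matrix_eq_cmc:
  assumes nz: "r \<noteq> 0" "q \<noteq> 0" "u \<noteq> 0" "z \<noteq> 0"
    and cnj: "cnj r = r" "cnj q = q" "cnj u = 1 / u" "cnj A = - (q * r * v / u)"
    and A: "A = y / (r * q * u)"
  shows "mat (1 / u) ** (gauge_matrix (n + 1) q **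
      mat2 (z + u\<^sup>2 * q\<^sup>2 / (r\<^sup>2 * z)) y v (z + u\<^sup>2 * r\<^sup>2 / (q\<^sup>2 * z)) ** matrix_inv (gauge_matrix n r)) =
    cmc_matrix (field_a n A) (field_b n r q u) z"
proof -
  have y: "y = A * (r * q * u)" and v: "v = - cnj A * u / (q * r)"
    using A cnj(4) nz by auto
  note expand = mat_eq_mat2 mat2_mult cmc_matrix_def mat2_eq_iff cnj(1-3) y v power2_eq_square
  show ?thesis
  proof (cases "even n")
    case True
    then have explicit: "matrix_inv (gauge_matrix n r) = mat2 r 0 0 (1 / r)" "gauge_matrix (n + 1) q = mat2 0 q (- 1 / q) 0"
      "field_a n A = - cnj A" "field_b n r q u = q / (r * u)"
      using nz by (simp_all add: gauge_matrix_inv(1)) (simp_all add: gauge_matrix_def field_a_def field_b_def)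
    show ?thesis unfolding explicit using nz by (simp add: expand field_simps)
  next
    case False
    then have explicit: "matrix_inv (gauge_matrix n r) = mat2 0 (- r) (1 / r) 0" "gauge_matrix (n + 1) q = mat2 (1 / q) 0 0 q"
      "field_a n A = A" "field_b n r q u = - r / (q * u)"
      using nz by (simp_all add: gauge_matrix_inv(1)) (simp_all add: gauge_matrix_def field_a_def field_b_def)
    show ?thesis unfolding explicit using nz by (simp add: expand field_simps)
  qed
qed

section \<open>Diagonal matrices as products of edge factors\<close>

context cross_ratio_s
begin

lemma factor_eq:
  "mat w + mat (1 / w) ** p_matrix f \<alpha> i x =
     mat2 w (\<alpha> i x * s (x + ee i) * s x / w) (- (\<alpha> i x / (s (x + ee i) * s x * w))) w"
proof -
  have "edge f i x = \<alpha> i x * s (x + ee i) * s x" by (simp add: edge_def f_step)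
  then show ?thesis
    using label_nonzero[of i x] s_nonzero[of x] s_nonzero[of "x + ee i"]
    by (simp add: p_matrix_def mat_eq_mat2 mat2_mult mat2_add mat2_eq_iff power2_eq_square)
qed

lemma diagonal_matrix_eq:
  fixes x
  assumes "i \<noteq> j" "w \<noteq> 0"
  defines "S \<equiv> s x" and "Si \<equiv> s (x + ee i)" and "Sij \<equiv> s (x + ee i + ee j)"
  shows "diagonal_matrix f \<alpha> i j x w =
     mat2 (w\<^sup>2 - \<alpha> i x * \<alpha> j x * Sij / (S * w\<^sup>2)) (Si * (\<alpha> i x * S + \<alpha> j x * Sij))
       (- (\<alpha> j x / (Si * Sij) + \<alpha> i x / (S * Si))) (w\<^sup>2 - \<alpha> i x * \<alpha> j x * S / (Sij * w\<^sup>2))"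
proof -
  have nz: "S \<noteq> 0" "Si \<noteq> 0" "Sij \<noteq> 0" unfolding S_def Si_def Sij_def by (rule s_nonzero)+
  have shift: "\<alpha> j (x + ee i) = \<alpha> j x" using label_shift assms(1) by metis
  show ?thesis
    unfolding diagonal_matrix_def factor_eq shift mat2_mult mat2_eq_iff
      S_def[symmetric] Si_def[symmetric] Sij_def[symmetric]
    using nz assms(2) by (simp add: power2_eq_square field_simps)
qed

text \<open>The diagonal entries are symmetric in \<open>i\<close> and \<open>j\<close>, and the
  off-diagonal ones agree by the quad equation. This is the zero curvature property of the edge
  factors on one quad.\<close>

lemma diagonal_matrix_commute:
  assumes "i \<noteq> j"
  shows "diagonal_matrix f \<alpha> i j x w = diagonal_matrix f \<alpha> j i x w"
proof (cases "w = 0")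
  \<comment> \<open>Division by zero yields zero, so every entry of the factors vanishes
    here.\<close>
  case True
  then show ?thesis unfolding diagonal_matrix_def factor_eq mat2_mult by simp
next
  case False
  define S Si Sj Sij where "S = s x" and "Si = s (x + ee i)" and "Sj = s (x + ee j)" and "Sij = s (x + ee i + ee j)"
  have nz: "S \<noteq> 0" "Si \<noteq> 0" "Sj \<noteq> 0" "Sij \<noteq> 0" unfolding S_def Si_def Sj_def Sij_def by (rule s_nonzero)+
  have q: "Si * (\<alpha> i x * S + \<alpha> j x * Sij) = Sj * (\<alpha> j x * S + \<alpha> i x * Sij)"
    using quad[OF assms, of x] unfolding S_def Si_def Sj_def Sij_def .
  have "\<alpha> j x / (Si * Sij) + \<alpha> i x / (S * Si) = (\<alpha> j x * S + \<alpha> i x * Sij) / (Si * S * Sij)"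
    "\<alpha> i x / (Sj * Sij) + \<alpha> j x / (S * Sj) = (\<alpha> i x * S + \<alpha> j x * Sij) / (Sj * S * Sij)"
    using nz by (simp_all add: field_simps)
  moreover have "(\<alpha> j x * S + \<alpha> i x * Sij) / (Si * S * Sij) = (\<alpha> i x * S + \<alpha> j x * Sij) / (Sj * S * Sij)"
    using q nz by (simp add: frac_eq_eq mult_ac)
  ultimately have "\<alpha> j x / (Si * Sij) + \<alpha> i x / (S * Si) = \<alpha> i x / (Sj * Sij) + \<alpha> j x / (S * Sj)" by simp
  then show ?thesis
    unfolding diagonal_matrix_eq[OF assms False] diagonal_matrix_eq[OF assms[symmetric] False]
      ee_commute[of x j i] mat2_eq_iff
      S_def[symmetric] Si_def[symmetric] Sj_def[symmetric] Sij_def[symmetric]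
    using q by (simp add: mult.commute)
qed

text \<open>Exchanging adjacent factors across four faces of the 4-cube carries the path with
  directions 1, 3, 2, 4 to the path 2, 4, 1, 3.\<close>

lemma diagonal_compatible:
  "diagonal_matrix f \<alpha> 2 4 (x + ee 1 + ee 3) w ** diagonal_matrix f \<alpha> 1 3 x w =
     diagonal_matrix f \<alpha> 1 3 (x + ee 2 + ee 4) w ** diagonal_matrix f \<alpha> 2 4 x w"
proof -
  define F where "F i x = mat w + mat (1 / w) ** p_matrix f \<alpha> i x" for i x
  have D: "diagonal_matrix f \<alpha> i j x w = F j (x + ee i) ** F i x" for i j x
    by (simp add: diagonal_matrix_def F_def)
  have swap: "F j (x + ee i) ** F i x = F i (x + ee j) ** F j x" if "i \<noteq> j" for i j x
    using diagonal_matrix_commute[OF that, of x w] unfolding D .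
  have 23: "F 2 (x + ee 1 + ee 3) ** F 3 (x + ee 1) = F 3 (x + ee 1 + ee 2) ** F 2 (x + ee 1)"
    and 21: "F 2 (x + ee 1) ** F 1 x = F 1 (x + ee 2) ** F 2 x"
    and 43: "F 4 (x + ee 1 + ee 2 + ee 3) ** F 3 (x + ee 1 + ee 2) =
      F 3 (x + ee 1 + ee 2 + ee 4) ** F 4 (x + ee 1 + ee 2)"
    and 41: "F 4 (x + ee 2 + ee 1) ** F 1 (x + ee 2) = F 1 (x + ee 2 + ee 4) ** F 4 (x + ee 2)"
    by (rule swap; simp)+
  have "F 4 (x + ee 1 + ee 3 + ee 2) ** F 2 (x + ee 1 + ee 3) ** (F 3 (x + ee 1) ** F 1 x) =
      F 4 (x + ee 1 + ee 2 + ee 3) ** (F 2 (x + ee 1 + ee 3) ** F 3 (x + ee 1)) ** F 1 x"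
    by (simp add: matrix_mul_assoc ee_commute[of "x + ee 1" 3 2])
  also have "\<dots> = (F 4 (x + ee 1 + ee 2 + ee 3) ** F 3 (x + ee 1 + ee 2)) ** (F 2 (x + ee 1) ** F 1 x)"
    unfolding 23 by (simp only: matrix_mul_assoc)
  also have "\<dots> = F 3 (x + ee 1 + ee 2 + ee 4) ** (F 4 (x + ee 1 + ee 2) ** F 1 (x + ee 2)) ** F 2 x"
    unfolding 43 21 by (simp only: matrix_mul_assoc)
  also have "F 4 (x + ee 1 + ee 2) ** F 1 (x + ee 2) = F 1 (x + ee 2 + ee 4) ** F 4 (x + ee 2)"
    using 41 by (simp only: ee_commute[of x 2 1])
  also have "x + ee 1 + ee 2 + ee 4 = x + ee 2 + ee 4 + ee 1" by (simp add: ac_simps)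
  finally show ?thesis unfolding D by (simp only: matrix_mul_assoc)
qed

text \<open>The determinant of an edge factor is
  \<open>w\<^sup>2 + (\<alpha> k y)\<^sup>2 / w\<^sup>2\<close>, in which \<open>s\<close> does not
  occur.\<close>

lemma det_diagonal_matrix_0_iff:
  assumes "i \<noteq> j" "w \<noteq> 0"
  shows "det (diagonal_matrix f \<alpha> i j x w) = 0 \<longleftrightarrow> (w\<^sup>2)\<^sup>2 = - (\<alpha> i x)\<^sup>2 \<or> (w\<^sup>2)\<^sup>2 = - (\<alpha> j x)\<^sup>2"
proof -
  have factor: "det (mat w + mat (1 / w) ** p_matrix f \<alpha> k y) = 0 \<longleftrightarrow> (w\<^sup>2)\<^sup>2 = - (\<alpha> k y)\<^sup>2" for k y
  proof -
    have "w\<^sup>2 * det (mat w + mat (1 / w) ** p_matrix f \<alpha> k y) = (w\<^sup>2)\<^sup>2 + (\<alpha> k y)\<^sup>2"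
      unfolding factor_eq det_mat2
      using assms(2) s_nonzero[of y] s_nonzero[of "y + ee k"] by (simp add: field_simps power2_eq_square)
    then show ?thesis using assms(2) by (metis add_eq_0_iff2 mult_eq_0_iff zero_eq_power2)
  qed
  have "\<alpha> j (x + ee i) = \<alpha> j x" using label_shift assms(1) by metis
  then show ?thesis unfolding diagonal_matrix_def det_mul by (auto simp: factor)
qed

text \<open>By commutation the factor of direction \<open>k\<close> may be taken as the right one,
  and it annihilates the vector.\<close>

lemma diagonal_matrix_kernel:
  assumes "i \<noteq> j" "w \<noteq> 0" and k: "k = i \<or> k = j" and w: "w\<^sup>2 = \<i> * \<alpha> k x"
  shows "diagonal_matrix f \<alpha> i j x w *v vector [s (x + ee k) * s x, - \<i>] = 0"
proof -
  have factor: "(mat w + mat (1 / w) ** p_matrix f \<alpha> k x) *v vector [s (x + ee k) * s x, - \<i>] = 0"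
  proof -
    have "\<alpha> k x = - \<i> * w\<^sup>2" using w by simp
    then show ?thesis
      unfolding factor_eq mat2_vector vector2_eq_0_iff
      using assms(2) s_nonzero[of x] s_nonzero[of "x + ee k"] by (simp add: field_simps power2_eq_square)
  qed
  obtain l where "diagonal_matrix f \<alpha> i j x w = diagonal_matrix f \<alpha> k l x w"
    using k diagonal_matrix_commute[OF assms(1)] by metis
  then show ?thesis
    unfolding diagonal_matrix_def by (simp add: factor flip: matrix_vector_mul_assoc)
qed

end

section \<open>Reflection of the kernels of a cmc matrix\<close>

lemma opposite_label:
  assumes "\<alpha> * cnj \<beta> = -1"
  shows "\<beta> = - 1 / cnj \<alpha>"
proof -
  have "\<alpha> \<noteq> 0" using assms by auto
  moreover have "cnj \<alpha> * \<beta> = -1" using arg_cong[OF assms, of cnj] by simp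
  ultimately show ?thesis by (auto simp: field_simps)
qed

lemma cnj_mult_eq_1: "x * cnj y = 1 \<Longrightarrow> y * cnj x = 1"
  by (drule arg_cong[of _ _ cnj]) (simp add: mult.commute)

lemma mat2_kernel_vector:
  "mat2 a (\<i> * p) (- \<i> * q) c *v kernel_vector n t = 0 \<longleftrightarrow>
     (if even n then a * t + p = 0 \<and> q * t + c = 0 else a + p * t = 0 \<and> q + c * t = 0)"
proof -
  have "\<i> * p * - \<i> = p" "- \<i> * q * t + c * - \<i> = - \<i> * (q * t + c)"
    "a * \<i> + \<i> * p * t = \<i> * (a + p * t)" "- \<i> * q * \<i> = q"
    by (simp_all add: distrib_left mult_ac)
  then show ?thesis by (simp add: kernel_vector_def mat2_vector vector2_eq_0_iff)
qed

text \<open>For \<open>z = \<i> * \<alpha>\<close> the point \<open>\<i> * \<beta>\<close> is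
  \<open>- 1 / cnj z\<close>, where the off-diagonal entries are the interchanged conjugates of
  those at \<open>z\<close>. Comparing the kernel equations at both points relates \<open>t\<close>
  to \<open>t'\<close>, because \<open>a\<close> is nonzero.\<close>

lemma cmc_kernels_reflected:
  assumes b: "b \<noteq> 0" and \<alpha>: "\<alpha> * cnj \<beta> = -1" "\<alpha>\<^sup>2 \<noteq> \<beta>\<^sup>2" and t: "t \<noteq> 0"
    and 1: "cmc_matrix a b (\<i> * \<alpha>) *v kernel_vector n t = 0"
    and 3: "cmc_matrix a b (\<i> * \<beta>) *v kernel_vector n t' = 0"
  shows "t * cnj t' = 1"
proof -
  have \<alpha>0: "\<alpha> \<noteq> 0" using \<alpha> by auto
  have \<beta>: "\<beta> = - 1 / cnj \<alpha>" by (rule opposite_label[OF \<alpha>(1)])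
  define P Q where "P = \<alpha> * b - 1 / (\<alpha> * b)" and "Q = \<alpha> / cnj b - cnj b / \<alpha>"
  have m1: "cmc_matrix a b (\<i> * \<alpha>) = mat2 a (\<i> * P) (- \<i> * Q) (cnj a)"
    unfolding cmc_matrix_def mat2_eq_iff P_def Q_def using b \<alpha>0 by (simp add: field_simps)
  have m3: "cmc_matrix a b (\<i> * \<beta>) = mat2 a (\<i> * cnj Q) (- \<i> * cnj P) (cnj a)"
    unfolding cmc_matrix_def mat2_eq_iff P_def Q_def \<beta> using b \<alpha>0 by (simp add: field_simps)
  have a0: "a \<noteq> 0" if "P = 0 \<Longrightarrow> Q = 0 \<Longrightarrow> False" "a = 0 \<Longrightarrow> P = 0 \<and> Q = 0"
    using that by blast
  \<comment> \<open>Vanishing of both off-diagonal entries would give \<open>\<alpha>\<close>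
    modulus 1 and thus \<open>\<beta>\<^sup>2 = \<alpha>\<^sup>2\<close>. This excludes
    \<open>a = 0\<close>, for which the kernel equations force \<open>P = Q = 0\<close>.\<close>
  have PQ: False if "P = 0" "Q = 0"
  proof -
    have eqs: "\<alpha> * b = 1 / (\<alpha> * b)" "\<alpha> / cnj b = cnj b / \<alpha>"
      using that unfolding P_def Q_def by simp_all
    have nz: "cnj b \<noteq> 0" "\<alpha> * b \<noteq> 0" using b \<alpha>0 by simp_all
    have cnj_b: "\<alpha> * \<alpha> = cnj b * cnj b" using eqs(2) unfolding frac_eq_eq[OF nz(1) \<alpha>0] .
    have "(\<alpha> * b) * (\<alpha> * b) = 1" using eqs(1) unfolding nonzero_eq_divide_eq[OF nz(2)] .
    then have "\<alpha>\<^sup>2 * b\<^sup>2 = 1" by (simp add: power2_eq_square mult_ac)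
    moreover have "b\<^sup>2 = (cnj \<alpha>)\<^sup>2" using arg_cong[OF cnj_b, of cnj] by (simp add: power2_eq_square)
    ultimately have "\<alpha>\<^sup>2 * (cnj \<alpha>)\<^sup>2 = 1" by simp
    then have "\<beta>\<^sup>2 = \<alpha>\<^sup>2" unfolding \<beta> using \<alpha>0 by (simp add: power_divide field_simps)
    then show False using \<alpha>(2) by simp
  qed
  show ?thesis
  proof (cases "even n")
    case True
    have e: "a * t + P = 0" "Q * t + cnj a = 0" and e3: "a * t' + cnj Q = 0"
      using 1 3 True unfolding m1 m3 mat2_kernel_vector by simp_all
    have "a \<noteq> 0" by (rule a0) (use PQ e t in auto)
    have "cnj Q * cnj t + a = 0" using arg_cong[OF e(2), of cnj] by simp
    moreover have "cnj Q = - (a * t')" using e3 by (simp add: add_eq_0_iff)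
    ultimately have "a * (1 - t' * cnj t) = 0" by (simp add: algebra_simps)
    then have "t' * cnj t = 1" using \<open>a \<noteq> 0\<close> by simp
    then show ?thesis by (rule cnj_mult_eq_1)
  next
    case False
    have e: "a + P * t = 0" "Q + cnj a * t = 0" and e3: "a + cnj Q * t' = 0"
      using 1 3 False unfolding m1 m3 mat2_kernel_vector by simp_all
    have "a \<noteq> 0" by (rule a0) (use PQ e t in auto)
    have "cnj Q + a * cnj t = 0" using arg_cong[OF e(2), of cnj] by simp
    then have "cnj Q = - (a * cnj t)" by (simp add: add_eq_0_iff)
    with e3 have "a * (1 - t' * cnj t) = 0" by (simp add: algebra_simps)
    then have "t' * cnj t = 1" using \<open>a \<noteq> 0\<close> by simp
    then show ?thesis by (rule cnj_mult_eq_1)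
  qed
qed

section \<open>Gauging one diagonal matrix to a cmc matrix\<close>

context cross_ratio_s
begin

definition root_s :: "int^4 \<Rightarrow> complex" where
  "root_s x = complex_of_real (sqrt (Re (s x)))"

lemma root_s:
  assumes "pos_real (s x)"
  shows "root_s x \<noteq> 0" "cnj (root_s x) = root_s x" "(root_s x)\<^sup>2 = s x"
proof -
  obtain r where r: "r > 0" "s x = complex_of_real r" using assms unfolding pos_real_def by blast
  then show "root_s x \<noteq> 0" "cnj (root_s x) = root_s x" "(root_s x)\<^sup>2 = s x"
    unfolding root_s_def by (simp_all flip: of_real_power)
qed

text \<open>Under the \<open>C\<^sup>+\<close> condition on labels its square is
  \<open>- \<alpha> i x * \<alpha> (i + 2) x\<close>, the label product in the diagonal entries of
  the diagonal matrix.\<close>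

definition phase :: "4 \<Rightarrow> int^4 \<Rightarrow> complex" where
  "phase i x = sgn (\<alpha> i x)"

lemma phase:
  "phase i x \<noteq> 0" "cnj (phase i x) = 1 / phase i x" "(phase i x)\<^sup>2 = \<alpha> i x / cnj (\<alpha> i x)"
proof -
  show nz: "phase i x \<noteq> 0" unfolding phase_def using label_nonzero by (simp add: sgn_zero_iff)
  have "phase i x * cnj (phase i x) = 1"
    using complex_norm_square[of "sgn (\<alpha> i x)"] label_nonzero unfolding phase_def by (simp add: norm_sgn)
  then show *: "cnj (phase i x) = 1 / phase i x" using nz by (simp add: field_simps)
  have "\<alpha> i x = complex_of_real (cmod (\<alpha> i x)) * phase i x"
    unfolding phase_def using label_nonzero by (simp add: sgn_eq)
  from arg_cong[OF this, of cnj] have "cnj (\<alpha> i x) = complex_of_real (cmod (\<alpha> i x)) / phase i x"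
    by (simp add: *)
  then have "(phase i x)\<^sup>2 * cnj (\<alpha> i x) = complex_of_real (cmod (\<alpha> i x)) * phase i x"
    using nz by (simp add: power2_eq_square)
  then have "(phase i x)\<^sup>2 * cnj (\<alpha> i x) = \<alpha> i x"
    using \<open>\<alpha> i x = complex_of_real (cmod (\<alpha> i x)) * phase i x\<close> by simp
  then show "(phase i x)\<^sup>2 = \<alpha> i x / cnj (\<alpha> i x)"
    using label_nonzero by (simp add: nonzero_eq_divide_eq)
qed

text \<open>The upper right entry of the diagonal matrix, normalized by the gauge at both ends and
  by the phase.\<close>

definition amplitude :: "4 \<Rightarrow> int^4 \<Rightarrow> complex" where
  "amplitude i x = (let x' = x + ee i + ee (i + 2) in
     s (x + ee i) * (\<alpha> i x * s x + \<alpha> (i + 2) x * s x') / (root_s x * root_s x' * phase i x))"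

definition edge_a :: "int \<Rightarrow> 4 \<Rightarrow> int^4 \<Rightarrow> complex" where
  "edge_a n i x = field_a n (amplitude i x)"

definition edge_b :: "int \<Rightarrow> 4 \<Rightarrow> int^4 \<Rightarrow> complex" where
  "edge_b n i x = field_b n (root_s x) (root_s (x + ee i + ee (i + 2))) (phase i x)"

lemma gauged_diagonal_matrix:
  assumes C: "C_plus_at \<alpha> s i x" and pos: "pos_real (s x)" "pos_real (s (x + ee i + ee (i + 2)))"
    and w: "w \<noteq> 0"
  shows "mat (1 / phase i x) ** (gauge_matrix (n + 1) (root_s (x + ee i + ee (i + 2))) **
      diagonal_matrix f \<alpha> i (i + 2) x w ** matrix_inv (gauge_matrix n (root_s x))) =
    cmc_matrix (edge_a n i x) (edge_b n i x) (w\<^sup>2)"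
proof -
  define r q u where "r = root_s x" and "q = root_s (x + ee i + ee (i + 2))" and "u = phase i x"
  define A S where "A = \<alpha> i x" and "S = s (x + ee i)"
  have i: "i \<noteq> i + 2" by simp
  have nz: "r \<noteq> 0" "q \<noteq> 0" "u \<noteq> 0" "A \<noteq> 0" "S \<noteq> 0"
    unfolding r_def q_def u_def A_def S_def using root_s pos phase label_nonzero s_nonzero by auto
  have cnj: "cnj r = r" "cnj q = q" "cnj u = 1 / u"
    unfolding r_def q_def u_def using root_s pos phase by auto
  have sq: "s x = r\<^sup>2" "s (x + ee i + ee (i + 2)) = q\<^sup>2" "u\<^sup>2 = A / cnj A"
    unfolding r_def q_def u_def A_def using root_s pos phase by auto
  have k: "\<alpha> (i + 2) x = - 1 / cnj A"
    unfolding A_def by (rule opposite_label) (use C in \<open>simp add: C_plus_at_def\<close>)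
  have S3: "s (x + ee (i + 2)) = 1 / cnj S"
  proof -
    have "S * cnj (s (x + ee (i + 2))) = 1" using C unfolding C_plus_at_def S_def by simp
    then have "s (x + ee (i + 2)) * cnj S = 1" by (rule cnj_mult_eq_1)
    then show ?thesis using nz by (simp add: nonzero_eq_divide_eq)
  qed
  define y v where "y = S * (A * r\<^sup>2 + - 1 / cnj A * q\<^sup>2)" and "v = - (- 1 / cnj A / (S * q\<^sup>2) + A / (r\<^sup>2 * S))"
  \<comment> \<open>The quad equation gives a second form of \<open>y\<close>. Conjugating this one
    produces \<open>v\<close> up to gauge factors, as the cmc form requires of the constant
    entries.\<close>
  have y': "y = 1 / cnj S * (- 1 / cnj A * r\<^sup>2 + A * q\<^sup>2)"
    using quad[OF i, of x] unfolding sq k S3 A_def[symmetric] S_def[symmetric] y_def .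
  have amp: "amplitude i x = y / (r * q * u)"
    unfolding amplitude_def Let_def sq k A_def[symmetric] S_def[symmetric] y_def r_def[symmetric] q_def[symmetric]
      u_def[symmetric] ..
  have A': "cnj A = A / u\<^sup>2" using sq(3) nz by simp
  have "cnj (y / (r * q * u)) = 1 / S * (- 1 / A * r\<^sup>2 + cnj A * q\<^sup>2) / (r * q) * u"
    unfolding y' by (simp add: cnj)
  also have "\<dots> = - (q * r * v / u)"
    unfolding v_def A' using nz by (simp add: field_simps power2_eq_square)
  finally have cnj_amp: "cnj (y / (r * q * u)) = - (q * r * v / u)" .
  have "diagonal_matrix f \<alpha> i (i + 2) x w =
      mat2 (w\<^sup>2 + u\<^sup>2 * q\<^sup>2 / (r\<^sup>2 * w\<^sup>2)) y v (w\<^sup>2 + u\<^sup>2 * r\<^sup>2 / (q\<^sup>2 * w\<^sup>2))"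
    unfolding diagonal_matrix_eq[OF i w] sq k A_def[symmetric] S_def[symmetric] y_def v_def
    using nz by (simp add: mat2_eq_iff)
  then show ?thesis
    using gauged_matrix_eq_cmc[OF nz(1,2,3) _ cnj cnj_amp refl, of "w\<^sup>2" n] w
    unfolding edge_a_def edge_b_def amp r_def[symmetric] q_def[symmetric] u_def[symmetric] by simp
qed

end

section \<open>The cmc solution of a lattice\<close>

locale C_plus = cross_ratio_s +
  assumes C_plus: "\<And>i j. C_plus_at \<alpha> s 1 (diag i j)" "\<And>i j. C_plus_at \<alpha> s 2 (diag i j)"
begin

text \<open>The parity is that of \<open>i + j\<close> in \<open>\<int>^2\<close>; as points of
  \<open>\<int>^4\<close> all vertices of the diagonal net are even.\<close>

definition gauge_at :: "int \<Rightarrow> int \<Rightarrow> complex^2^2" where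
  "gauge_at i j = gauge_matrix (i + j) (root_s (diag i j))"

definition cmc_L :: lax where
  "cmc_L i j = cmc_matrix (edge_a (i + j) 1 (diag i j)) (edge_b (i + j) 1 (diag i j))"

definition cmc_M :: lax where
  "cmc_M i j = cmc_matrix (edge_a (i + j) 2 (diag i j)) (edge_b (i + j) 2 (diag i j))"

lemma s_pos: "pos_real (s (diag i j))"
  by (rule s_pos_diag) (rule C_plus)+

lemma root_s_nonzero: "root_s (diag i j) \<noteq> 0"
  by (rule root_s(1)) (rule s_pos)

lemma cmc_L_eq:
  assumes "w \<noteq> 0"
  shows "cmc_L i j (w\<^sup>2) = mat (1 / phase 1 (diag i j)) **
    (gauge_at (i + 1) j ** diagonal_matrix f \<alpha> 1 3 (diag i j) w ** matrix_inv (gauge_at i j))"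
proof -
  have "pos_real (s (diag i j + ee 1 + ee (1 + 2)))" using s_pos by (simp add: diag_add_ee)
  note gauged = gauged_diagonal_matrix[OF C_plus(1) s_pos this assms, of "i + j"]
  have shift: "i + 1 + j = i + j + 1" by simp
  show ?thesis
    unfolding cmc_L_def gauge_at_def shift using gauged by (simp add: diag_add_ee)
qed

lemma cmc_M_eq:
  assumes "w \<noteq> 0"
  shows "cmc_M i j (w\<^sup>2) = mat (1 / phase 2 (diag i j)) **
    (gauge_at i (j + 1) ** diagonal_matrix f \<alpha> 2 4 (diag i j) w ** matrix_inv (gauge_at i j))"
proof -
  have "pos_real (s (diag i j + ee 2 + ee (2 + 2)))" using s_pos by (simp add: diag_add_ee)
  note gauged = gauged_diagonal_matrix[OF C_plus(2) s_pos this assms, of "i + j"]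
  have shift: "i + (j + 1) = i + j + 1" by simp
  show ?thesis
    unfolding cmc_M_def gauge_at_def shift using gauged by (simp add: diag_add_ee)
qed

lemma edge_b_nonzero: "edge_b (i + j) 1 (diag i j) \<noteq> 0" "edge_b (i + j) 2 (diag i j) \<noteq> 0"
  by (simp_all add: edge_b_def field_b_def diag_add_ee root_s_nonzero phase)

lemma cmc_fun_LM: "cmc_fun (cmc_L i j)" "cmc_fun (cmc_M i j)"
  unfolding cmc_fun_def cmc_L_def cmc_M_def using edge_b_nonzero by blast+

lemma gauge_at: "invertible (gauge_at i j)" "matrix_inv (gauge_at i j) ** gauge_at i j = mat 1"
proof -
  show inv: "invertible (gauge_at i j)"
    unfolding gauge_at_def by (rule gauge_matrix_inv(2)) (rule root_s_nonzero)
  then obtain B where "gauge_at i j ** B = mat 1" "B ** gauge_at i j = mat 1"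
    unfolding invertible_def by blast
  then show "matrix_inv (gauge_at i j) ** gauge_at i j = mat 1" using matrix_inv_unique by metis
qed

lemma phase_shift: "phase 1 (diag i (j + 1)) = phase 1 (diag i j)" "phase 2 (diag (i + 1) j) = phase 2 (diag i j)"
proof -
  have "\<alpha> 1 (diag i (j + 1)) = \<alpha> 1 (diag i j)" "\<alpha> 2 (diag (i + 1) j) = \<alpha> 2 (diag i j)"
    by (rule label_cong; simp)+
  then show "phase 1 (diag i (j + 1)) = phase 1 (diag i j)" "phase 2 (diag (i + 1) j) = phase 2 (diag i j)"
    unfolding phase_def by simp_all
qed

text \<open>The scalars are the inverse phases. The phase of each direction is constant along the
  other one, which is why they do not affect compatibility.\<close>

lemma gauge_related_cmc:
  "gauge_related (\<lambda>z. z) (\<lambda>z. z\<^sup>2)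
     (\<lambda>i j. diagonal_matrix f \<alpha> 1 3 (diag i j), \<lambda>i j. diagonal_matrix f \<alpha> 2 4 (diag i j)) (cmc_L, cmc_M)"
  unfolding gauge_related_def split
proof (rule exI[of _ gauge_at], rule exI[of _ "\<lambda>i j. 1 / phase 1 (diag i j)"],
    rule exI[of _ "\<lambda>i j. 1 / phase 2 (diag i j)"], intro conjI allI impI)
  fix i j and z :: complex assume "cmod z = 1"
  then have "z \<noteq> 0" by auto
  then show "cmc_L i j (z\<^sup>2) = mat (1 / phase 1 (diag i j)) **
      (gauge_at (i + 1) j ** diagonal_matrix f \<alpha> 1 3 (diag i j) z ** matrix_inv (gauge_at i j))"
    "cmc_M i j (z\<^sup>2) = mat (1 / phase 2 (diag i j)) **
      (gauge_at i (j + 1) ** diagonal_matrix f \<alpha> 2 4 (diag i j) z ** matrix_inv (gauge_at i j))"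
    by (rule cmc_L_eq, rule cmc_M_eq)
qed (simp_all add: gauge_at phase phase_shift)

lemma compatible_diagonal:
  "compatible (\<lambda>i j. diagonal_matrix f \<alpha> 1 3 (diag i j)) (\<lambda>i j. diagonal_matrix f \<alpha> 2 4 (diag i j))"
  unfolding compatible_def
proof (intro allI impI)
  fix i j z
  show "diagonal_matrix f \<alpha> 2 4 (diag (i + 1) j) z ** diagonal_matrix f \<alpha> 1 3 (diag i j) z =
      diagonal_matrix f \<alpha> 1 3 (diag i (j + 1)) z ** diagonal_matrix f \<alpha> 2 4 (diag i j) z"
    using diagonal_compatible[of "diag i j" z] by (simp only: diag_add_ee)
qed

text \<open>Everything is evaluated at a square root \<open>w\<close> of \<open>z\<close>; in a
  product along two edges the gauge at the common vertex cancels.\<close>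

lemma compatible_cmc: "compatible cmc_L cmc_M"
  unfolding compatible_def
proof (intro allI impI)
  fix i j and z :: complex assume "cmod z = 1"
  define w where "w = csqrt z"
  have w: "w \<noteq> 0" "w\<^sup>2 = z" using \<open>cmod z = 1\<close> unfolding w_def by auto
  define D1 D2 D1' D2' where "D1 = diagonal_matrix f \<alpha> 1 3 (diag i j) w" and "D2 = diagonal_matrix f \<alpha> 2 4 (diag i j) w"
    and "D1' = diagonal_matrix f \<alpha> 1 3 (diag i (j + 1)) w" and "D2' = diagonal_matrix f \<alpha> 2 4 (diag (i + 1) j) w"
  have D: "D2' ** D1 = D1' ** D2"
    unfolding D1_def D2_def D1'_def D2'_def using diagonal_compatible[of "diag i j" w] by (simp only: diag_add_ee)
  have compose: "mat c ** (H2 ** X ** matrix_inv (gauge_at k l)) ** (mat d ** (gauge_at k l ** Y ** H0)) =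
      mat (c * d) ** (H2 ** (X ** Y) ** H0)" for c d k l and H2 X Y H0 :: "complex^2^2"
  proof -
    have "H2 ** X ** matrix_inv (gauge_at k l) ** (gauge_at k l ** Y ** H0) =
        H2 ** X ** (matrix_inv (gauge_at k l) ** gauge_at k l) ** Y ** H0"
      by (simp only: matrix_mul_assoc)
    then show ?thesis unfolding mat_mult_mat_mult gauge_at by (simp add: matrix_mul_assoc)
  qed
  show "cmc_M (i + 1) j z ** cmc_L i j z = cmc_L i (j + 1) z ** cmc_M i j z"
    unfolding w(2)[symmetric] cmc_L_eq[OF w(1)] cmc_M_eq[OF w(1)] compose phase_shift
      D1_def[symmetric] D2_def[symmetric] D1'_def[symmetric] D2'_def[symmetric] D
    by (simp add: mult.commute)
qed

section \<open>Singular points and kernels of the cmc solution\<close>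

lemma labels_on_diag:
  "\<alpha> 1 (diag i j) = \<alpha> 1 (diag i 0)" "\<alpha> 3 (diag i j) = \<alpha> 3 (diag i 0)"
  "\<alpha> 2 (diag i j) = \<alpha> 2 (diag 0 j)" "\<alpha> 4 (diag i j) = \<alpha> 4 (diag 0 j)"
  by (rule label_cong; simp)+

lemma det_roots:
  assumes "z \<noteq> 0"
  shows "det (cmc_L i j z) = 0 \<longleftrightarrow> z\<^sup>2 = - (\<alpha> 1 (diag i 0))\<^sup>2 \<or> z\<^sup>2 = - (\<alpha> 3 (diag i 0))\<^sup>2"
    and "det (cmc_M i j z) = 0 \<longleftrightarrow> z\<^sup>2 = - (\<alpha> 2 (diag 0 j))\<^sup>2 \<or> z\<^sup>2 = - (\<alpha> 4 (diag 0 j))\<^sup>2"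
proof -
  define w where "w = csqrt z"
  have w: "w \<noteq> 0" "w\<^sup>2 = z" using assms unfolding w_def by auto
  have det_gauge: "det (gauge_at k l) = 1" "det (matrix_inv (gauge_at k l)) = 1" for k l
    unfolding gauge_at_def by (rule gauge_matrix_inv(3,4)[OF root_s_nonzero])+
  have det_scalar: "det (mat c :: complex^2^2) = c * c" for c by (simp add: mat_eq_mat2 det_mat2)
  have "det (cmc_L i j z) = 0 \<longleftrightarrow> det (diagonal_matrix f \<alpha> 1 3 (diag i j) w) = 0"
    unfolding w(2)[symmetric] cmc_L_eq[OF w(1)] det_mul det_gauge det_scalar using phase by simp
  then show "det (cmc_L i j z) = 0 \<longleftrightarrow> z\<^sup>2 = - (\<alpha> 1 (diag i 0))\<^sup>2 \<or> z\<^sup>2 = - (\<alpha> 3 (diag i 0))\<^sup>2"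
    using det_diagonal_matrix_0_iff[of 1 3 w "diag i j"] w by (simp add: labels_on_diag[of i j])
  have "det (cmc_M i j z) = 0 \<longleftrightarrow> det (diagonal_matrix f \<alpha> 2 4 (diag i j) w) = 0"
    unfolding w(2)[symmetric] cmc_M_eq[OF w(1)] det_mul det_gauge det_scalar using phase by simp
  then show "det (cmc_M i j z) = 0 \<longleftrightarrow> z\<^sup>2 = - (\<alpha> 2 (diag 0 j))\<^sup>2 \<or> z\<^sup>2 = - (\<alpha> 4 (diag 0 j))\<^sup>2"
    using det_diagonal_matrix_0_iff[of 2 4 w "diag i j"] w by (simp add: labels_on_diag[of i j])
qed

lemma labels_separated:
  "(\<alpha> 1 (diag i 0))\<^sup>2 \<noteq> (\<alpha> 3 (diag i 0))\<^sup>2" "(\<alpha> 2 (diag 0 j))\<^sup>2 \<noteq> (\<alpha> 4 (diag 0 j))\<^sup>2"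
  "(\<alpha> 1 (diag i 0))\<^sup>2 \<noteq> (\<alpha> 2 (diag 0 j))\<^sup>2" "(\<alpha> 1 (diag i 0))\<^sup>2 \<noteq> (\<alpha> 4 (diag 0 j))\<^sup>2"
  "(\<alpha> 3 (diag i 0))\<^sup>2 \<noteq> (\<alpha> 2 (diag 0 j))\<^sup>2" "(\<alpha> 3 (diag i 0))\<^sup>2 \<noteq> (\<alpha> 4 (diag 0 j))\<^sup>2"
  unfolding labels_on_diag(1)[of i j, symmetric] labels_on_diag(2)[of i j, symmetric]
    labels_on_diag(3)[of i j, symmetric] labels_on_diag(4)[of i j, symmetric]
  by (rule labels_square_distinct; simp)+

lemma no_common_root:
  assumes "z \<noteq> 0"
  shows "det (cmc_L i j z) \<noteq> 0 \<or> det (cmc_M i j z) \<noteq> 0"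
  unfolding det_roots[OF assms] using labels_separated(3-6)[of i j] by (metis neg_equal_iff_equal)

lemma label_opposite:
  "\<alpha> 1 (diag i j) * cnj (\<alpha> 3 (diag i j)) = -1" "\<alpha> 2 (diag i j) * cnj (\<alpha> 4 (diag i j)) = -1"
  using C_plus[of i j] by (simp_all add: C_plus_at_def)

text \<open>A label of modulus 1 would be the negative of the opposite label, although their squares
  differ. Consequently the cmc matrices are regular at \<open>z = 1\<close>.\<close>

lemma label_not_unit: "cmod (\<alpha> k (diag i j)) \<noteq> 1"
proof -
  have not_unit: "cmod a \<noteq> 1 \<and> cmod b \<noteq> 1" if "a * cnj b = -1" "a\<^sup>2 \<noteq> b\<^sup>2" for a b
  proof -
    have prod: "cmod a * cmod b = 1" using arg_cong[OF that(1), of cmod] by (simp add: norm_mult)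
    have "cmod a \<noteq> 1"
    proof
      assume "cmod a = 1"
      then have "a * cnj a = 1" using complex_norm_square[of a] by simp
      then have "cnj a = 1 / a" by (metis mult_zero_left nonzero_eq_divide_eq mult.commute zero_neq_one)
      then have "b = - a" using opposite_label[OF that(1)] by simp
      then show False using that(2) by simp
    qed
    with prod show ?thesis by auto
  qed
  have "(\<alpha> 1 (diag i j))\<^sup>2 \<noteq> (\<alpha> 3 (diag i j))\<^sup>2" "(\<alpha> 2 (diag i j))\<^sup>2 \<noteq> (\<alpha> 4 (diag i j))\<^sup>2"
    by (rule labels_square_distinct; simp)+
  note not_unit[OF label_opposite(1) this(1)] not_unit[OF label_opposite(2) this(2)]
  with exhaust_4[of k] show ?thesis by (elim disjE; hypsubst; blast)
qed

lemma det_1_nonzero: "det (cmc_L i j 1) \<noteq> 0" "det (cmc_M i j 1) \<noteq> 0"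
proof -
  have "1\<^sup>2 \<noteq> - (\<alpha> k (diag i j))\<^sup>2" for k i j
  proof
    assume "1\<^sup>2 = - (\<alpha> k (diag i j))\<^sup>2"
    then have "(cmod (\<alpha> k (diag i j)))\<^sup>2 = 1" by (metis norm_minus_cancel norm_one norm_power power_one)
    then show False using label_not_unit[of k i j] norm_ge_zero[of "\<alpha> k (diag i j)"] by (simp add: power2_eq_1_iff)
  qed
  then show "det (cmc_L i j 1) \<noteq> 0" "det (cmc_M i j 1) \<noteq> 0"
    by (simp_all only: det_roots one_neq_zero not_False_eq_True simp_thms)
qed

lemma gauge_inv_kernel_vector:
  "\<exists>c. matrix_inv (gauge_at i j) *v kernel_vector (i + j) t = mat c *v vector [t * s (diag i j), - \<i>]"
  using gauge_matrix_inv_kernel_vector[OF root_s_nonzero] unfolding gauge_at_def root_s(3)[OF s_pos, symmetric] .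

text \<open>The gauge carries the given vector to a multiple of the kernel vector of the diagonal
  matrix, taken at a square root of the singular point.\<close>

lemma kernel_L:
  assumes "k = 1 \<or> k = 3"
  shows "cmc_L i j (\<i> * \<alpha> k (diag i j)) *v kernel_vector (i + j) (s (diag i j + ee k)) = 0"
proof -
  define w where "w = csqrt (\<i> * \<alpha> k (diag i j))"
  have w: "w \<noteq> 0" "w\<^sup>2 = \<i> * \<alpha> k (diag i j)" unfolding w_def using label_nonzero by auto
  obtain c where c: "matrix_inv (gauge_at i j) *v kernel_vector (i + j) (s (diag i j + ee k)) =
      mat c *v vector [s (diag i j + ee k) * s (diag i j), - \<i>]" using gauge_inv_kernel_vector by blast
  have "diagonal_matrix f \<alpha> 1 3 (diag i j) w *v vector [s (diag i j + ee k) * s (diag i j), - \<i>] = 0"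
    by (rule diagonal_matrix_kernel) (use assms w in auto)
  then have "diagonal_matrix f \<alpha> 1 3 (diag i j) w *v (mat c *v vector [s (diag i j + ee k) * s (diag i j), - \<i>]) = 0"
    by (simp only: matrix_vector_mul_assoc mat_scalar_mult_commute[symmetric])
       (simp flip: matrix_vector_mul_assoc)
  then show ?thesis
    unfolding w(2)[symmetric] cmc_L_eq[OF w(1)] by (simp add: c flip: matrix_vector_mul_assoc)
qed

lemma kernel_M:
  assumes "k = 2 \<or> k = 4"
  shows "cmc_M i j (\<i> * \<alpha> k (diag i j)) *v kernel_vector (i + j) (s (diag i j + ee k)) = 0"
proof -
  define w where "w = csqrt (\<i> * \<alpha> k (diag i j))"
  have w: "w \<noteq> 0" "w\<^sup>2 = \<i> * \<alpha> k (diag i j)" unfolding w_def using label_nonzero by auto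
  obtain c where c: "matrix_inv (gauge_at i j) *v kernel_vector (i + j) (s (diag i j + ee k)) =
      mat c *v vector [s (diag i j + ee k) * s (diag i j), - \<i>]" using gauge_inv_kernel_vector by blast
  have "diagonal_matrix f \<alpha> 2 4 (diag i j) w *v vector [s (diag i j + ee k) * s (diag i j), - \<i>] = 0"
    by (rule diagonal_matrix_kernel) (use assms w in auto)
  then have "diagonal_matrix f \<alpha> 2 4 (diag i j) w *v (mat c *v vector [s (diag i j + ee k) * s (diag i j), - \<i>]) = 0"
    by (simp only: matrix_vector_mul_assoc mat_scalar_mult_commute[symmetric])
       (simp flip: matrix_vector_mul_assoc)
  then show ?thesis
    unfolding w(2)[symmetric] cmc_M_eq[OF w(1)] by (simp add: c flip: matrix_vector_mul_assoc)
qed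

lemma initial_data_cmc: "initial_data cmc_L cmc_M \<alpha> s"
proof -
  have "cmc_L n 0 (\<i> * \<alpha> k (diag n 0)) *v kernel_vector n (s (diag n 0 + ee k)) = 0" if "k \<in> {1, 3}" for k n
    using kernel_L[of k n 0] that by simp
  moreover have "cmc_M 0 n (\<i> * \<alpha> k (diag 0 n)) *v kernel_vector n (s (diag 0 n + ee k)) = 0" if "k \<in> {2, 4}" for k n
    using kernel_M[of k 0 n] that by simp
  ultimately show ?thesis
    unfolding initial_data_def Let_def using label_opposite by blast
qed

lemma cmc_in_representation: "(cmc_L, cmc_M) \<in> cmc_representation"
proof -
  have "nondegenerate_solution cmc_L cmc_M"
    unfolding nondegenerate_solution_def using no_common_root crs smap initial_data_cmc by blast
  moreover have "cmc_L = (\<lambda>i j. cmc_matrix (edge_a (i + j) 1 (diag i j)) (edge_b (i + j) 1 (diag i j)))"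
    "cmc_M = (\<lambda>i j. cmc_matrix (edge_a (i + j) 2 (diag i j)) (edge_b (i + j) 2 (diag i j)))"
    by (intro ext, simp only: cmc_L_def, intro ext, simp only: cmc_M_def)
  moreover have "\<forall>i j. edge_b (i + j) 1 (diag i j) \<noteq> 0 \<and> edge_b (i + j) 2 (diag i j) \<noteq> 0"
    using edge_b_nonzero by blast
  ultimately show ?thesis
    unfolding cmc_representation_def mem_Collect_eq split using compatible_cmc by (intro exI conjI)
qed

end

section \<open>From a cmc solution back to a lattice\<close>

lemma C_plus_lattice_imp_C_plus:
  assumes "C_plus_lattice f \<alpha>"
  obtains s where "C_plus f \<alpha> s"
  using assms unfolding C_plus_lattice_iff C_plus_def C_plus_axioms_def by blast

lemma C_plus_imp_C_plus_lattice: "C_plus f \<alpha> s \<Longrightarrow> C_plus_lattice f \<alpha>"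
  unfolding C_plus_lattice_iff C_plus_def C_plus_axioms_def by blast

lemma initial_data_kernels:
  assumes "initial_data L M \<alpha> s"
  shows "k \<in> {1, 3} \<Longrightarrow> L n 0 (\<i> * \<alpha> k (diag n 0)) *v kernel_vector n (s (diag n 0 + ee k)) = 0"
    and "k \<in> {2, 4} \<Longrightarrow> M 0 n (\<i> * \<alpha> k (diag 0 n)) *v kernel_vector n (s (diag 0 n + ee k)) = 0"
proof -
  note data = assms[unfolded initial_data_def Let_def]
  show "k \<in> {1, 3} \<Longrightarrow> L n 0 (\<i> * \<alpha> k (diag n 0)) *v kernel_vector n (s (diag n 0 + ee k)) = 0"
    by (rule data[THEN conjunct1, THEN spec, THEN conjunct2, THEN bspec])
  show "k \<in> {2, 4} \<Longrightarrow> M 0 n (\<i> * \<alpha> k (diag 0 n)) *v kernel_vector n (s (diag 0 n + ee k)) = 0"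
    by (rule data[THEN conjunct2, THEN spec, THEN conjunct2, THEN bspec])
qed

text \<open>By \<open>cmc_kernels_reflected\<close> the kernels of the matrices on the axes satisfy
  the conditions on \<open>s\<close> there, and \<open>C_plus_from_axes\<close> extends these to the
  diagonal net.\<close>

lemma initial_data_imp_C_plus:
  assumes cr: "cross_ratio_s f \<alpha> s" and cmc: "\<And>i j. cmc_fun (L i j)" "\<And>i j. cmc_fun (M i j)"
    and data: "initial_data L M \<alpha> s"
  shows "C_plus f \<alpha> s"
proof -
  interpret cross_ratio_s f \<alpha> s by (rule cr)
  have "C_plus_at \<alpha> s 1 (diag n 0)" for n
  proof -
    obtain a b where ab: "b \<noteq> 0" "L n 0 = cmc_matrix a b" using cmc(1)[of n 0] unfolding cmc_fun_def by blast
    have op: "\<alpha> 1 (diag n 0) * cnj (\<alpha> 3 (diag n 0)) = -1"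
      and ker: "\<And>k. k \<in> {1, 3} \<Longrightarrow> L n 0 (\<i> * \<alpha> k (diag n 0)) *v kernel_vector n (s (diag n 0 + ee k)) = 0"
      using data unfolding initial_data_def Let_def by blast+
    have "s (diag n 0 + ee 1) * cnj (s (diag n 0 + ee 3)) = 1"
      by (rule cmc_kernels_reflected[OF ab(1) op _ s_nonzero])
         (use ker[of 1] ker[of 3] ab(2) labels_square_distinct[of 1 3] in simp_all)
    then show ?thesis using op by (simp add: C_plus_at_def)
  qed
  moreover have "C_plus_at \<alpha> s 2 (diag 0 n)" for n
  proof -
    obtain a b where ab: "b \<noteq> 0" "M 0 n = cmc_matrix a b" using cmc(2)[of 0 n] unfolding cmc_fun_def by blast
    have op: "\<alpha> 2 (diag 0 n) * cnj (\<alpha> 4 (diag 0 n)) = -1"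
      and ker: "\<And>k. k \<in> {2, 4} \<Longrightarrow> M 0 n (\<i> * \<alpha> k (diag 0 n)) *v kernel_vector n (s (diag 0 n + ee k)) = 0"
      using data unfolding initial_data_def Let_def by blast+
    have "s (diag 0 n + ee 2) * cnj (s (diag 0 n + ee 4)) = 1"
      by (rule cmc_kernels_reflected[OF ab(1) op _ s_nonzero])
         (use ker[of 2] ker[of 4] ab(2) labels_square_distinct[of 2 4] in simp_all)
    then show ?thesis using op by (simp add: C_plus_at_def)
  qed
  ultimately show ?thesis
    using C_plus_from_axes by unfold_locales blast+
qed

lemma kernel_vector_nonzero: "kernel_vector n t \<noteq> 0"
  by (simp add: kernel_vector_def vector2_eq_0_iff)

text \<open>Both solutions have the same initial data, hence a common kernel vector at a common
  singular point on every edge of the axes. This fixes the matrices there up to sign, and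
  \<open>agree_everywhere\<close> does the rest.\<close>

lemma initial_data_unique:
  assumes "C_plus f \<alpha> s" and cmc: "\<And>i j. cmc_fun (L i j)" "\<And>i j. cmc_fun (M i j)"
    and comp: "compatible L M" and root: "\<And>i j z. z \<noteq> 0 \<Longrightarrow> det (L i j z) \<noteq> 0 \<or> det (M i j z) \<noteq> 0"
    and data: "initial_data L M \<alpha> s"
  shows "sign_eq (L i j) (C_plus.cmc_L \<alpha> s i j)" "sign_eq (M i j) (C_plus.cmc_M \<alpha> s i j)"
proof -
  interpret C_plus f \<alpha> s by (rule assms(1))
  interpret cmp: cmc_pair_comparison L M cmc_L cmc_M "\<lambda>i. \<i> * \<alpha> 1 (diag i 0)" "\<lambda>i. \<i> * \<alpha> 3 (diag i 0)"
      "\<lambda>j. \<i> * \<alpha> 2 (diag 0 j)" "\<lambda>j. \<i> * \<alpha> 4 (diag 0 j)"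
  proof
    show "cmc_fun (L i j)" "cmc_fun (M i j)" "cmc_fun (cmc_L i j)" "cmc_fun (cmc_M i j)" for i j
      by (rule cmc cmc_fun_LM)+
    show "compatible L M" "compatible cmc_L cmc_M" by (rule comp compatible_cmc)+
    show "det (L i j z) \<noteq> 0 \<or> det (M i j z) \<noteq> 0" if "z \<noteq> 0" for i j z using root that by blast
  qed (simp_all add: det_roots label_nonzero power_mult_distrib labels_separated)
  have "sign_eq (L n 0) (cmc_L n 0)" for n
  proof (rule cmc_fun_sign_eq[where z = "\<i> * \<alpha> 1 (diag n 0)" and
        w = "kernel_vector n (s (diag n 0 + ee 1))", OF cmc(1) cmc_fun_LM(1) _ kernel_vector_nonzero])
    show "L n 0 (\<i> * \<alpha> 1 (diag n 0)) *v kernel_vector n (s (diag n 0 + ee 1)) = 0"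
      by (rule initial_data_kernels(1)[OF data]) simp
    show "cmc_L n 0 (\<i> * \<alpha> 1 (diag n 0)) *v kernel_vector n (s (diag n 0 + ee 1)) = 0"
      by (rule initial_data_kernels(1)[OF initial_data_cmc]) simp
  qed (simp add: label_nonzero)
  moreover have "sign_eq (M 0 n) (cmc_M 0 n)" for n
  proof (rule cmc_fun_sign_eq[where z = "\<i> * \<alpha> 2 (diag 0 n)" and
        w = "kernel_vector n (s (diag 0 n + ee 2))", OF cmc(2) cmc_fun_LM(2) _ kernel_vector_nonzero])
    show "M 0 n (\<i> * \<alpha> 2 (diag 0 n)) *v kernel_vector n (s (diag 0 n + ee 2)) = 0"
      by (rule initial_data_kernels(2)[OF data]) simp
    show "cmc_M 0 n (\<i> * \<alpha> 2 (diag 0 n)) *v kernel_vector n (s (diag 0 n + ee 2)) = 0"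
      by (rule initial_data_kernels(2)[OF initial_data_cmc]) simp
  qed (simp add: label_nonzero)
  ultimately show "sign_eq (L i j) (cmc_L i j)" "sign_eq (M i j) (cmc_M i j)"
    using cmp.agree_everywhere by blast+
qed

section \<open>Reparametrizations and the equivalence\<close>

lemma reparametrization_id: "reparametrization (\<lambda>z. z)"
  unfolding reparametrization_def by simp

lemma reparametrization_square: "reparametrization (\<lambda>z. z\<^sup>2)"
proof -
  have "z \<in> (\<lambda>z. z\<^sup>2) ` sphere 0 1" if "z \<in> sphere 0 1" for z :: complex
  proof
    show "z = (csqrt z)\<^sup>2" by simp
    show "csqrt z \<in> sphere 0 1" using that by (simp add: norm_csqrt)
  qed
  then show ?thesis
    unfolding reparametrization_def by (auto intro!: continuous_intros simp: norm_power)
qed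

theorem theorem4p9:
  shows "gauge_equivalent cmc_representation C_plus_representation"
proof -
  have C_plus_case: "compatible (fst Q) (snd Q) \<and> (\<exists>P \<in> cmc_representation. gauge_related (\<lambda>z. z) (\<lambda>z. z\<^sup>2) Q P)"
    if Q_in: "Q \<in> C_plus_representation" for Q
  proof -
    obtain f \<alpha> where C: "C_plus_lattice f \<alpha>" and
      Q: "Q = (\<lambda>i j. diagonal_matrix f \<alpha> 1 3 (diag i j), \<lambda>i j. diagonal_matrix f \<alpha> 2 4 (diag i j))"
      using Q_in unfolding C_plus_representation_def by blast
    obtain s where "C_plus f \<alpha> s" by (rule C_plus_lattice_imp_C_plus[OF C])
    then interpret C_plus f \<alpha> s .
    show ?thesis
      unfolding Q fst_conv snd_conv
      by (intro conjI bexI[of _ "(cmc_L, cmc_M)"]) (rule compatible_diagonal gauge_related_cmc cmc_in_representation)+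
  qed
  have cmc_case: "\<exists>Q \<in> C_plus_representation. gauge_related (\<lambda>z. z\<^sup>2) (\<lambda>z. z) (L, M) Q"
    if LM_in: "(L, M) \<in> cmc_representation" for L M
  proof -
    obtain a b d e where be: "\<And>i j. b i j \<noteq> 0 \<and> e i j \<noteq> 0"
      and LM: "L = (\<lambda>i j. cmc_matrix (a i j) (b i j))" "M = (\<lambda>i j. cmc_matrix (d i j) (e i j))"
      and comp: "compatible L M" and nondeg: "nondegenerate_solution L M"
      using LM_in unfolding cmc_representation_def by blast
    have cmc: "cmc_fun (L i j)" "cmc_fun (M i j)" for i j
      unfolding LM cmc_fun_def using be by blast+
    obtain f \<alpha> s where fs: "cross_ratio_system f \<alpha>" "is_s_map f \<alpha> s" and data: "initial_data L M \<alpha> s"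
      and root: "\<And>i j z. z \<noteq> 0 \<Longrightarrow> det (L i j z) \<noteq> 0 \<or> det (M i j z) \<noteq> 0"
      using nondeg unfolding nondegenerate_solution_def by blast
    \<comment> \<open>The cross-ratio system provided by nondegeneracy is the lattice sought. Its
      own cmc solution differs from \<open>(L, M)\<close> by signs only, so the reversed gauge
      relation applies after adjusting the scalars.\<close>
    have C: "C_plus f \<alpha> s"
      by (rule initial_data_imp_C_plus[OF cross_ratio_s.intro[OF fs] cmc data])
    interpret C_plus f \<alpha> s by (rule C)
    have "gauge_related (\<lambda>z. z\<^sup>2) (\<lambda>z. z) (L, M)
        (\<lambda>i j. diagonal_matrix f \<alpha> 1 3 (diag i j), \<lambda>i j. diagonal_matrix f \<alpha> 2 4 (diag i j))"
      by (rule gauge_related_sign_eq[OF gauge_related_sym[OF gauge_related_cmc] comp compatible_cmc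
            initial_data_unique[OF C cmc comp root data] det_1_nonzero])
    moreover have "(\<lambda>i j. diagonal_matrix f \<alpha> 1 3 (diag i j), \<lambda>i j. diagonal_matrix f \<alpha> 2 4 (diag i j))
        \<in> C_plus_representation"
      unfolding C_plus_representation_def using C_plus_imp_C_plus_lattice[OF C] by blast
    ultimately show ?thesis by blast
  qed
  have "compatible L M" if "(L, M) \<in> cmc_representation" for L M
    using that unfolding cmc_representation_def by blast
  then have "\<forall>(L, M) \<in> cmc_representation. compatible L M" by blast
  moreover have "\<forall>(L, M) \<in> C_plus_representation. compatible L M" using C_plus_case by fastforce
  moreover have "\<forall>P \<in> cmc_representation. \<exists>Q \<in> C_plus_representation. gauge_related (\<lambda>z. z\<^sup>2) (\<lambda>z. z) P Q"
    using cmc_case by (metis prod.collapse)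
  ultimately show ?thesis
    unfolding gauge_equivalent_def
    using C_plus_case reparametrization_id reparametrization_square by blast
qed

end
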